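(* Let $G$ be a residually finite, discrete, countable group and $(\overleftarrow{G},G)$ be a free odometer such that $\overleftarrow{G}$ has a group structure. Let $x\in\{0,1\}^G$. The following statements are equivalent: (1) $x$ is a Toeplitz array such that $(\overleftarrow{G},G)$ is the maximal equicontinuous factor of $(\overline{O_G(x)},G)$. (2) $x$ is the model set associated to a proper, irredundant, generic window $W\subseteq\overleftarrow{G}$.
   Context: Let $(\Gamma_n)_{n\in\mathbb{N}}$ be a decreasing sequence of finite index subgroups of $G$. The associated $G$-odometer is the inverse limit $\overleftarrow{G}=\{(g_n\Gamma_n)_{n}\in\prod_n G/\Gamma_n: g_{n+1}\Gamma_n=g_n\Gamma_n\ \forall n\}$ (with the topology induced by the product of discrete topologies), on which $G$ acts by coordinatewise left multiplication. It has a group structure if all $\Gamma_n$ are normal; then $\overleftarrow{G}$ is a compact metrizable group, and $\tau:G\to\overleftarrow{G}$, $\tau(g)=(g\Gamma_n)_n$, is a homomorphism with dense image and $g\cdot\xi=\tau(g)\xi$. In this case the odometer is called free if moreover $\bigcap_n\Gamma_n=\{1_G\}$ (so $\tau$ is injective). The space $\{0,1\}^G$ carries the product topology and the shift action $(gx)(h)=x(hg)$; $\overline{O_G(x)}$ is the closure of the orbit of $x$. An array $x\in\{0,1\}^G$ is Toeplitz if for every $g\in G$ there is a finite index subgroup $\Gamma_g$ of $G$ with $x(g\gamma)=x(g)$ for all $\gamma\in\Gamma_g$. The maximal equicontinuous factor (MEF) of a topological dynamical system is its largest equicontinuous factor: every equicontinuous factor of the system factors through it; it is unique up to conjugacy,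 and statements about being "the MEF" are up to conjugacy. For $W\subseteq\overleftarrow{G}$ (a window), the model set associated to $W$ is the array $x_W\in\{0,1\}^G$ with $x_W(g)=1\iff\tau(g)\in W$. The window $W$ is proper if it is compact with $\overline{\mathrm{int}(W)}=W$, irredundant if $W\xi=W$ implies $\xi=1_{\overleftarrow{G}}$, and generic if $\partial W\cap\tau(G)=\emptyset$. *)

theory Defs
  imports "HOL-Analysis.Analysis" "HOL-Algebra.Left_Coset"
begin

section \<open>Finite index subgroups\<close>

definition finite_index_subgroup :: "('g, 'm) monoid_scheme \<Rightarrow> 'g set \<Rightarrow> bool" where
  "finite_index_subgroup G H \<longleftrightarrow> subgroup H G \<and> finite (lcosets\<^bsub>G\<^esub> H)"

definition residually_finite :: "('g, 'm) monoid_scheme \<Rightarrow> bool" where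
  "residually_finite G \<longleftrightarrow>
     (\<forall>g\<in>carrier G. g \<noteq> \<one>\<^bsub>G\<^esub> \<longrightarrow> (\<exists>N. N \<lhd> G \<and> finite_index_subgroup G N \<and> g \<notin> N))"


section \<open>Topological dynamical systems\<close>

text \<open>A system is a compact metrizable space \<open>X\<close> together with a left action \<open>a\<close> of the (discrete)
  group \<open>G\<close> by continuous maps; the values of \<open>a g\<close> outside \<open>topspace X\<close> are irrelevant.\<close>

definition dynamical_system ::
    "('g, 'm) monoid_scheme \<Rightarrow> 'x topology \<Rightarrow> ('g \<Rightarrow> 'x \<Rightarrow> 'x) \<Rightarrow> bool" where
  "dynamical_system G X a \<longleftrightarrow>
     compact_space X \<and> metrizable_space X \<and>
     (\<forall>g\<in>carrier G. continuous_map X X (a g)) \<and>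
     (\<forall>x\<in>topspace X. a \<one>\<^bsub>G\<^esub> x = x) \<and>
     (\<forall>g\<in>carrier G. \<forall>h\<in>carrier G. \<forall>x\<in>topspace X. a (g \<otimes>\<^bsub>G\<^esub> h) x = a g (a h x))"

text \<open>As \<open>X\<close> is compact, all metrics inducing its topology are uniformly equivalent, so the choice
  of the metric \<open>d\<close> does not matter.\<close>

definition equicontinuous_system ::
    "('g, 'm) monoid_scheme \<Rightarrow> 'x topology \<Rightarrow> ('g \<Rightarrow> 'x \<Rightarrow> 'x) \<Rightarrow> bool" where
  "equicontinuous_system G X a \<longleftrightarrow>
     dynamical_system G X a \<and>
     (\<exists>d. Metric_space (topspace X) d \<and> Metric_space.mtopology (topspace X) d = X \<and>
        (\<forall>\<epsilon>>0. \<exists>\<delta>>0. \<forall>x\<in>topspace X. \<forall>y\<in>topspace X.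
           d x y < \<delta> \<longrightarrow> (\<forall>g\<in>carrier G. d (a g x) (a g y) < \<epsilon>)))"

definition factor_map ::
    "('g, 'm) monoid_scheme \<Rightarrow> 'x topology \<Rightarrow> ('g \<Rightarrow> 'x \<Rightarrow> 'x)
       \<Rightarrow> 'y topology \<Rightarrow> ('g \<Rightarrow> 'y \<Rightarrow> 'y) \<Rightarrow> ('x \<Rightarrow> 'y) \<Rightarrow> bool" where
  "factor_map G X a Y b \<phi> \<longleftrightarrow>
     dynamical_system G X a \<and> dynamical_system G Y b \<and>
     continuous_map X Y \<phi> \<and> \<phi> ` topspace X = topspace Y \<and>
     (\<forall>g\<in>carrier G. \<forall>x\<in>topspace X. \<phi> (a g x) = b g (\<phi> x))"

text \<open>HOL cannot quantify over all types of spaces \<open>Y\<close>, so the test factors below live on the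
  type \<open>'x\<close> of points of \<open>X\<close>. This is no restriction: a factor of \<open>X\<close> has at most as many points
  as \<open>X\<close>, hence is conjugate to one on the type \<open>'x\<close>. The lemma \<open>is_MEF_universal\<close> gives
  the universal property for factors on an arbitrary type.\<close>

definition is_MEF ::
    "('g, 'm) monoid_scheme \<Rightarrow> 'x topology \<Rightarrow> ('g \<Rightarrow> 'x \<Rightarrow> 'x)
       \<Rightarrow> 'z topology \<Rightarrow> ('g \<Rightarrow> 'z \<Rightarrow> 'z) \<Rightarrow> bool" where
  "is_MEF G X a Z c \<longleftrightarrow>
     equicontinuous_system G Z c \<and>
     (\<exists>\<pi>. factor_map G X a Z c \<pi> \<and>
        (\<forall>(Y :: 'x topology) b \<phi>. equicontinuous_system G Y b \<and> factor_map G X a Y b \<phi> \<longrightarrow>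
           (\<exists>\<psi>. factor_map G Z c Y b \<psi> \<and> (\<forall>x\<in>topspace X. \<phi> x = \<psi> (\<pi> x)))))"

lemma factor_map_compose:
  assumes "factor_map G X a Y b \<phi>" and "factor_map G Y b Z c \<psi>"
  shows "factor_map G X a Z c (\<psi> \<circ> \<phi>)"
  unfolding factor_map_def
proof (intro conjI ballI)
  have img: "\<phi> ` topspace X = topspace Y" "\<psi> ` topspace Y = topspace Z"
    using assms by (auto simp: factor_map_def)
  then show "(\<psi> \<circ> \<phi>) ` topspace X = topspace Z"
    by (metis image_comp)
  show "(\<psi> \<circ> \<phi>) (a g x) = c g ((\<psi> \<circ> \<phi>) x)" if "g \<in> carrier G" "x \<in> topspace X" for g x
  proof -
    have "\<phi> x \<in> topspace Y" using img that by blast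
    then show ?thesis using assms that by (simp add: factor_map_def)
  qed
qed (use assms in \<open>auto simp: factor_map_def intro: continuous_map_compose\<close>)

lemma equicontinuous_system_transfer:
  fixes X :: "'x topology" and Y :: "'y topology"
  assumes eq: "equicontinuous_system G Y b" and s: "inj_on s (topspace Y)"
  shows "\<exists>(Y' :: 'x topology) b' r. equicontinuous_system G Y' b' \<and> factor_map G Y b Y' b' s \<and>
           factor_map G Y' b' Y b r \<and> (\<forall>y\<in>topspace Y. r (s y) = y)"
proof -
  define M where "M = topspace Y"
  define r where "r = inv_into M s"
  define b' where "b' = (\<lambda>g u. s (b g (r u)))"
  have rs: "r (s y) = y" if "y \<in> M" for y
    using that s by (simp add: r_def M_def)
  have sr: "s (r u) = u" and rM: "r u \<in> M" if "u \<in> s ` M" for u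
    using that by (auto simp: rs)
  obtain d where d: "Metric_space M d" and top: "Metric_space.mtopology M d = Y"
    and equi: "\<forall>\<epsilon>>0. \<exists>\<delta>>0. \<forall>x\<in>M. \<forall>y\<in>M. d x y < \<delta> \<longrightarrow> (\<forall>g\<in>carrier G. d (b g x) (b g y) < \<epsilon>)"
    using eq unfolding equicontinuous_system_def M_def by blast
  have sys: "dynamical_system G Y b"
    using eq by (simp add: equicontinuous_system_def)
  interpret Y: Metric_space M d by (rule d)
  define d' where "d' = (\<lambda>u v. d (r u) (r v))"
  interpret Y': Metric_space "s ` M" d'
    by unfold_locales (auto simp: d'_def rs Y.commute intro: Y.triangle)
  have cs: "continuous_map Y Y'.mtopology s"
    unfolding top[symmetric]
    by (subst Metric_space.metric_continuous_map[OF d Y'.Metric_space_axioms])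
       (auto simp: d'_def rs)
  have cr: "continuous_map Y'.mtopology Y r"
    unfolding top[symmetric]
    by (subst Metric_space.metric_continuous_map[OF Y'.Metric_space_axioms d])
       (auto simp: d'_def rs)
  have bM: "b g y \<in> M" if "g \<in> carrier G" "y \<in> M" for g y
    using sys that unfolding dynamical_system_def continuous_map_def M_def by blast
  have sys': "dynamical_system G Y'.mtopology b'"
    unfolding dynamical_system_def
  proof (intro conjI ballI)
    have "compactin Y'.mtopology (s ` topspace Y)"
      using sys image_compactin[OF _ cs] by (simp add: dynamical_system_def compact_space_def)
    then show "compact_space Y'.mtopology"
      by (simp only: compact_space_def M_def[symmetric] Y'.topspace_mtopology)
    show "metrizable_space Y'.mtopology"
      by (rule Y'.metrizable_space_mtopology)
  next
    fix g assume g: "g \<in> carrier G"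
    have "continuous_map Y Y (b g)"
      using sys g by (simp add: dynamical_system_def)
    from continuous_map_compose[OF continuous_map_compose[OF cr this] cs]
    show "continuous_map Y'.mtopology Y'.mtopology (b' g)"
      by (simp add: b'_def comp_def)
  next
    fix u assume "u \<in> topspace Y'.mtopology"
    then show "b' \<one>\<^bsub>G\<^esub> u = u"
      using sys by (auto simp: b'_def dynamical_system_def M_def[symmetric] rs)
  next
    fix g h u assume "g \<in> carrier G" "h \<in> carrier G" "u \<in> topspace Y'.mtopology"
    then show "b' (g \<otimes>\<^bsub>G\<^esub> h) u = b' g (b' h u)"
      using sys by (auto simp: b'_def dynamical_system_def M_def[symmetric] rs bM)
  qed
  have "equicontinuous_system G Y'.mtopology b'"
    unfolding equicontinuous_system_def
  proof (intro conjI exI[of _ d'])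
    show "dynamical_system G Y'.mtopology b'" by (rule sys')
    show "Metric_space (topspace Y'.mtopology) d'"
      using Y'.Metric_space_axioms by simp
    show "Metric_space.mtopology (topspace Y'.mtopology) d' = Y'.mtopology"
      by simp
    show "\<forall>\<epsilon>>0. \<exists>\<delta>>0. \<forall>x\<in>topspace Y'.mtopology. \<forall>y\<in>topspace Y'.mtopology.
        d' x y < \<delta> \<longrightarrow> (\<forall>g\<in>carrier G. d' (b' g x) (b' g y) < \<epsilon>)"
      using equi unfolding Y'.topspace_mtopology by (simp add: d'_def b'_def rs bM)
  qed
  moreover have "factor_map G Y b Y'.mtopology b' s"
    using sys sys' cs by (auto simp: factor_map_def b'_def M_def[symmetric] rs)
  moreover have "factor_map G Y'.mtopology b' Y b r"
    using sys sys' cr by (auto simp: factor_map_def b'_def M_def[symmetric] rs bM image_image)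
  ultimately show ?thesis
    using rs unfolding M_def by blast
qed

lemma is_MEF_universal:
  fixes X :: "'x topology"
  assumes "is_MEF G X a Z c"
  shows "\<exists>\<pi>. factor_map G X a Z c \<pi> \<and>
           (\<forall>(Y :: 'y topology) b \<phi>. equicontinuous_system G Y b \<and> factor_map G X a Y b \<phi> \<longrightarrow>
              (\<exists>\<psi>. factor_map G Z c Y b \<psi> \<and> (\<forall>x\<in>topspace X. \<phi> x = \<psi> (\<pi> x))))"
proof -
  from assms obtain \<pi> where \<pi>: "factor_map G X a Z c \<pi>"
    and univ: "\<And>(Y :: 'x topology) b \<phi>. equicontinuous_system G Y b \<Longrightarrow> factor_map G X a Y b \<phi> \<Longrightarrow>
           \<exists>\<psi>. factor_map G Z c Y b \<psi> \<and> (\<forall>x\<in>topspace X. \<phi> x = \<psi> (\<pi> x))"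
    unfolding is_MEF_def by metis
  have "\<exists>\<psi>. factor_map G Z c Y b \<psi> \<and> (\<forall>x\<in>topspace X. \<phi> x = \<psi> (\<pi> x))"
    if Y: "equicontinuous_system G Y b" and \<phi>: "factor_map G X a Y b \<phi>"
    for Y :: "'y topology" and b \<phi>
  proof -
    have img: "\<phi> ` topspace X = topspace Y"
      using \<phi> by (simp add: factor_map_def)
    then have "inj_on (inv_into (topspace X) \<phi>) (topspace Y)"
      by (metis inj_on_inv_into order_refl)
    from equicontinuous_system_transfer[OF Y this] obtain Y' :: "'x topology" and b' s r
      where Y': "equicontinuous_system G Y' b'" and s: "factor_map G Y b Y' b' s"
        and r: "factor_map G Y' b' Y b r" and rs: "\<forall>y\<in>topspace Y. r (s y) = y"
      by blast
    from univ[OF Y' factor_map_compose[OF \<phi> s]] obtain \<psi>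
      where \<psi>: "factor_map G Z c Y' b' \<psi>" and eq: "\<forall>x\<in>topspace X. (s \<circ> \<phi>) x = \<psi> (\<pi> x)"
      by blast
    have "\<phi> x = (r \<circ> \<psi>) (\<pi> x)" if "x \<in> topspace X" for x
      using that eq rs img by (metis comp_apply imageI)
    with factor_map_compose[OF \<psi> r] show ?thesis
      by blast
  qed
  with \<pi> show ?thesis by blast
qed


section \<open>The full shift and Toeplitz arrays\<close>

definition full_shift :: "('g, 'm) monoid_scheme \<Rightarrow> ('g \<Rightarrow> nat) topology" where
  "full_shift G = product_topology (\<lambda>_. discrete_topology {0, 1}) (carrier G)"

definition shift_act :: "('g, 'm) monoid_scheme \<Rightarrow> 'g \<Rightarrow> ('g \<Rightarrow> nat) \<Rightarrow> ('g \<Rightarrow> nat)" where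
  "shift_act G g x = (\<lambda>h\<in>carrier G. x (h \<otimes>\<^bsub>G\<^esub> g))"

definition orbit_closure :: "('g, 'm) monoid_scheme \<Rightarrow> ('g \<Rightarrow> nat) \<Rightarrow> ('g \<Rightarrow> nat) topology" where
  "orbit_closure G x =
     subtopology (full_shift G)
       (full_shift G closure_of ((\<lambda>g. shift_act G g x) ` carrier G))"

definition Toeplitz :: "('g, 'm) monoid_scheme \<Rightarrow> ('g \<Rightarrow> nat) \<Rightarrow> bool" where
  "Toeplitz G x \<longleftrightarrow>
     x \<in> topspace (full_shift G) \<and>
     (\<forall>g\<in>carrier G. \<exists>H. finite_index_subgroup G H \<and> (\<forall>\<gamma>\<in>H. x (g \<otimes>\<^bsub>G\<^esub> \<gamma>) = x g))"


section \<open>Odometers\<close>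

definition odometer_sequence :: "('g, 'm) monoid_scheme \<Rightarrow> (nat \<Rightarrow> 'g set) \<Rightarrow> bool" where
  "odometer_sequence G \<Gamma> \<longleftrightarrow>
     (\<forall>n. finite_index_subgroup G (\<Gamma> n)) \<and> (\<forall>n. \<Gamma> (Suc n) \<subseteq> \<Gamma> n)"

definition odometer_set :: "('g, 'm) monoid_scheme \<Rightarrow> (nat \<Rightarrow> 'g set) \<Rightarrow> (nat \<Rightarrow> 'g set) set" where
  "odometer_set G \<Gamma> =
     {(\<lambda>n. g n <#\<^bsub>G\<^esub> \<Gamma> n) | g.
        (\<forall>n. g n \<in> carrier G) \<and> (\<forall>n. g (Suc n) <#\<^bsub>G\<^esub> \<Gamma> n = g n <#\<^bsub>G\<^esub> \<Gamma> n)}"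

definition odometer :: "('g, 'm) monoid_scheme \<Rightarrow> (nat \<Rightarrow> 'g set) \<Rightarrow> (nat \<Rightarrow> 'g set) topology" where
  "odometer G \<Gamma> =
     subtopology (product_topology (\<lambda>n. discrete_topology (lcosets\<^bsub>G\<^esub> (\<Gamma> n))) UNIV)
       (odometer_set G \<Gamma>)"

definition odometer_act :: "('g, 'm) monoid_scheme \<Rightarrow> 'g \<Rightarrow> (nat \<Rightarrow> 'g set) \<Rightarrow> (nat \<Rightarrow> 'g set)" where
  "odometer_act G g \<xi> = (\<lambda>n. g <#\<^bsub>G\<^esub> \<xi> n)"

definition odometer_tau :: "('g, 'm) monoid_scheme \<Rightarrow> (nat \<Rightarrow> 'g set) \<Rightarrow> 'g \<Rightarrow> (nat \<Rightarrow> 'g set)" where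
  "odometer_tau G \<Gamma> g = (\<lambda>n. g <#\<^bsub>G\<^esub> \<Gamma> n)"

text \<open>This is a group if all \<open>\<Gamma> n\<close> are normal: the product of cosets is then the product in
  \<open>G Mod \<Gamma> n\<close>, taken coordinatewise.\<close>

definition odometer_group :: "('g, 'm) monoid_scheme \<Rightarrow> (nat \<Rightarrow> 'g set) \<Rightarrow> (nat \<Rightarrow> 'g set) monoid" where
  "odometer_group G \<Gamma> =
     \<lparr>carrier = odometer_set G \<Gamma>, mult = (\<lambda>\<xi> \<eta> n. \<xi> n <#>\<^bsub>G\<^esub> \<eta> n), one = \<Gamma>\<rparr>"


section \<open>Windows and model sets\<close>

definition proper_window :: "('g, 'm) monoid_scheme \<Rightarrow> (nat \<Rightarrow> 'g set) \<Rightarrow> (nat \<Rightarrow> 'g set) set \<Rightarrow> bool" where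
  "proper_window G \<Gamma> W \<longleftrightarrow>
     compactin (odometer G \<Gamma>) W \<and>
     odometer G \<Gamma> closure_of (odometer G \<Gamma> interior_of W) = W"

definition irredundant_window :: "('g, 'm) monoid_scheme \<Rightarrow> (nat \<Rightarrow> 'g set) \<Rightarrow> (nat \<Rightarrow> 'g set) set \<Rightarrow> bool" where
  "irredundant_window G \<Gamma> W \<longleftrightarrow>
     (\<forall>\<xi>\<in>carrier (odometer_group G \<Gamma>).
        W #>\<^bsub>odometer_group G \<Gamma>\<^esub> \<xi> = W \<longrightarrow> \<xi> = \<one>\<^bsub>odometer_group G \<Gamma>\<^esub>)"

definition generic_window :: "('g, 'm) monoid_scheme \<Rightarrow> (nat \<Rightarrow> 'g set) \<Rightarrow> (nat \<Rightarrow> 'g set) set \<Rightarrow> bool" where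
  "generic_window G \<Gamma> W \<longleftrightarrow>
     (odometer G \<Gamma> frontier_of W) \<inter> (odometer_tau G \<Gamma> ` carrier G) = {}"

definition model_set :: "('g, 'm) monoid_scheme \<Rightarrow> (nat \<Rightarrow> 'g set) \<Rightarrow> (nat \<Rightarrow> 'g set) set \<Rightarrow> ('g \<Rightarrow> nat)" where
  "model_set G \<Gamma> W = (\<lambda>g\<in>carrier G. if odometer_tau G \<Gamma> g \<in> W then 1 else 0)"

end

theory Submission
  imports Defs
begin

text \<open>
  Write \<open>O\<close> for the odometer, \<open>\<tau>\<close> for the canonical map \<open>G \<rightarrow> O\<close> and \<open>X\<close> for the orbit closure
  of \<open>x\<close>. Both directions come down to one picture: \<open>X\<close> maps onto \<open>O\<close> equivariantly, and the
  fibre through \<open>x\<close> is a single point.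

  Let \<open>x\<close> be the model set of a proper, irredundant, generic window \<open>W\<close>. Genericity keeps \<open>\<tau> g\<close> off
  the boundary of \<open>W\<close>, so the value \<open>x g\<close> is already decided by the coset of \<open>g\<close> modulo some
  \<open>\<Gamma> n\<close>; hence \<open>x\<close> is Toeplitz. To build the factor map, take the closure of all pairs
  \<open>(g x, \<tau> g)\<close> in \<open>X \<times> O\<close>. If it contains \<open>(y, \<xi>)\<close>, then \<open>y h = 1\<close> whenever \<open>\<tau> h \<xi>\<close> is interior
  to \<open>W\<close>, and \<open>y h = 0\<close> whenever \<open>\<tau> h \<xi>\<close> is outside \<open>W\<close>. As \<open>W\<close> is the closure of its interior and
  \<open>\<tau>\<close> has dense image, \<open>y\<close> determines the translate \<open>W \<xi>\<^sup>-\<^sup>1\<close>, and by irredundance it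
  determines \<open>\<xi>\<close> (lemma \<open>graph_closure_unique\<close>). So the closed relation is the graph of a continuous
  factor map \<open>\<pi>\<close>, and the fibre of \<open>\<pi>\<close> over the identity is \<open>{x}\<close>. Any two points of one fibre of
  \<open>\<pi>\<close> can be moved simultaneously towards that fibre, so they are proximal. An
  equicontinuous factor cannot separate proximal points, hence it factors through \<open>\<pi>\<close>
  (lemma \<open>is_MEF_model_set\<close>).

  Conversely, let \<open>x\<close> be Toeplitz with maximal equicontinuous factor \<open>\<pi> : X \<rightarrow> O\<close>. If \<open>H\<close> is a normal
  subgroup of finite index along which \<open>x g\<close> is constant, the closure of the \<open>H\<close>-orbit of \<open>x\<close> is
  \<open>H\<close>-minimal, so its finitely many translates partition \<open>X\<close> and form a finite factor. Its cell
  around \<open>x\<close> only contains points that agree with \<open>x\<close> at \<open>g\<close>. Since finite factors are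
  equicontinuous, they factor through \<open>\<pi>\<close>; letting \<open>g\<close> vary, the fibre of \<open>\<pi>\<close> through \<open>x\<close> is \<open>{x}\<close>
  (lemma \<open>MEF_fibre_singleton\<close>). By compactness, points that lie near this fibre are near \<open>x\<close>, so the
  periods of \<open>x\<close> can be chosen among the \<open>\<Gamma> n\<close>, and \<open>x g\<close> is a locally constant function of \<open>\<tau> g\<close>
  on the image of \<open>\<tau>\<close>. The closure of the open set where this function is \<open>1\<close> is the window. If
  \<open>W \<xi> = W\<close> and \<open>\<tau> g\<close> tends to \<open>\<xi>\<close>, then \<open>g x\<close> tends to \<open>x\<close>, so \<open>\<pi> (g x)\<close> tends to \<open>\<pi> x\<close>, which
  forces \<open>\<xi>\<close> to be the identity.
\<close>

section \<open>Finite index subgroups\<close>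

context group
begin

lemma l_coset_eq_iff:
  assumes "subgroup H G" "g \<in> carrier G" "h \<in> carrier G"
  shows "g <# H = h <# H \<longleftrightarrow> inv g \<otimes> h \<in> H"
proof
  assume "g <# H = h <# H"
  then have "h \<in> g <# H" using assms lcos_self by blast
  then show "inv g \<otimes> h \<in> H"
    using assms subgroup.lcos_module_imp is_group by metis
next
  assume "inv g \<otimes> h \<in> H"
  then have "g \<otimes> (inv g \<otimes> h) \<in> g <# H" by (auto simp: l_coset_def)
  then have "h \<in> g <# H" using assms by (simp add: m_assoc[symmetric])
  then show "g <# H = h <# H"
    using assms l_repr_independence by blast
qed

lemma l_coset_mem_lcosets: "g \<in> carrier G \<Longrightarrow> g <# H \<in> lcosets H"
  by (auto simp: LCOSETS_def)

text \<open>Applied with a pair of cosets as the invariant for an intersection of subgroups, and with the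
  permutation of the cosets for a normal core.\<close>

lemma finite_index_by_invariant:
  assumes N: "subgroup N G" and fin: "finite (f ` carrier G)"
    and f: "\<And>g h. \<lbrakk>g \<in> carrier G; h \<in> carrier G; f g = f h\<rbrakk> \<Longrightarrow> inv g \<otimes> h \<in> N"
  shows "finite_index_subgroup G N"
proof -
  have "lcosets N \<subseteq> (\<lambda>t. inv_into (carrier G) f t <# N) ` f ` carrier G"
  proof
    fix c assume "c \<in> lcosets N"
    then obtain g where g: "g \<in> carrier G" "c = g <# N" by (auto simp: LCOSETS_def)
    let ?h = "inv_into (carrier G) f (f g)"
    have "?h \<in> carrier G" "f ?h = f g"
      using g(1) by (auto intro: inv_into_into f_inv_into_f)
    then have "?h <# N = c"
      using f g N l_coset_eq_iff by metis
    then show "c \<in> (\<lambda>t. inv_into (carrier G) f t <# N) ` f ` carrier G"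
      using g(1) by blast
  qed
  then show ?thesis
    using N fin finite_subset unfolding finite_index_subgroup_def by blast
qed

lemma finite_index_Int:
  assumes "finite_index_subgroup G H" "finite_index_subgroup G K"
  shows "finite_index_subgroup G (H \<inter> K)"
proof (rule finite_index_by_invariant[where f = "\<lambda>g. (g <# H, g <# K)"])
  show "subgroup (H \<inter> K) G"
    using assms subgroups_Inter_pair unfolding finite_index_subgroup_def by blast
  have "(\<lambda>g. (g <# H, g <# K)) ` carrier G \<subseteq> (lcosets H) \<times> (lcosets K)"
    by (auto intro: l_coset_mem_lcosets)
  then show "finite ((\<lambda>g. (g <# H, g <# K)) ` carrier G)"
    using assms finite_subset unfolding finite_index_subgroup_def by blast
qed (use assms l_coset_eq_iff in \<open>auto simp: finite_index_subgroup_def\<close>)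

lemma finite_index_carrier: "finite_index_subgroup G (carrier G)"
  by (rule finite_index_by_invariant[where f = "\<lambda>_. ()"]) (auto simp: subgroup_self)

text \<open>The intersection of all conjugates of \<open>H\<close> is the kernel of the action of \<open>G\<close> on the finitely
  many cosets of \<open>H\<close>, and a kernel has as many cosets as there are permutations in the image.\<close>

lemma finite_index_normal_core:
  assumes "finite_index_subgroup G H"
  obtains N where "N \<lhd> G" "finite_index_subgroup G N" "N \<subseteq> H"
proof -
  have H: "subgroup H G" and fin: "finite (lcosets H)"
    using assms by (auto simp: finite_index_subgroup_def)
  define N where "N = {n \<in> carrier G. \<forall>a\<in>carrier G. inv a \<otimes> n \<otimes> a \<in> H}"
  have Hs: "\<And>u. u \<in> H \<Longrightarrow> u \<in> carrier G" using H subgroup.subset by blast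
  have sub: "subgroup N G"
  proof (rule subgroupI)
    show "N \<subseteq> carrier G" by (auto simp: N_def)
    show "N \<noteq> {}"
      using H subgroup.one_closed by (force simp: N_def)
  next
    fix n assume n: "n \<in> N"
    have "inv a \<otimes> inv n \<otimes> a \<in> H" if a: "a \<in> carrier G" for a
    proof -
      have "inv (inv a \<otimes> n \<otimes> a) \<in> H"
        using n a H subgroup.m_inv_closed by (fastforce simp: N_def)
      then show ?thesis
        using n a by (simp add: N_def inv_mult_group m_assoc)
    qed
    then show "inv n \<in> N" using n by (simp add: N_def)
  next
    fix n m assume n: "n \<in> N" and m: "m \<in> N"
    have "inv a \<otimes> (n \<otimes> m) \<otimes> a \<in> H" if a: "a \<in> carrier G" for a
    proof -
      have "(inv a \<otimes> n \<otimes> a) \<otimes> (inv a \<otimes> m \<otimes> a) \<in> H"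
        using n m a H subgroup.m_closed by (fastforce simp: N_def)
      moreover have "a \<otimes> (inv a \<otimes> (m \<otimes> a)) = m \<otimes> a"
        using m a by (simp add: N_def flip: m_assoc)
      ultimately show ?thesis
        using n m a by (simp add: N_def m_assoc)
    qed
    then show "n \<otimes> m \<in> N" using n m by (simp add: N_def)
  qed
  moreover have "x \<otimes> n \<otimes> inv x \<in> N" if x: "x \<in> carrier G" and n: "n \<in> N" for x n
  proof -
    have "inv a \<otimes> (x \<otimes> n \<otimes> inv x) \<otimes> a \<in> H" if a: "a \<in> carrier G" for a
    proof -
      have "inv (inv x \<otimes> a) \<otimes> n \<otimes> (inv x \<otimes> a) \<in> H"
        using n x a by (simp add: N_def)
      then show ?thesis
        using n x a by (simp add: N_def inv_mult_group m_assoc)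
    qed
    then show ?thesis using n x by (simp add: N_def)
  qed
  ultimately have "N \<lhd> G" by (simp add: normal_inv_iff)
  moreover have "N \<subseteq> H"
  proof
    fix n assume n: "n \<in> N"
    then have "inv \<one> \<otimes> n \<otimes> \<one> \<in> H" unfolding N_def by blast
    then show "n \<in> H" using n by (simp add: N_def)
  qed
  moreover have "finite_index_subgroup G N"
  \<comment> \<open>The inverses make equality of two invariants say exactly that
    \<open>inv g \<otimes> h\<close> fixes every coset.\<close>
  proof (rule finite_index_by_invariant[OF sub, where f = "\<lambda>g. \<lambda>c\<in>lcosets H. inv g <# c"])
    have cl: "inv g <# c \<in> lcosets H" if "g \<in> carrier G" "c \<in> lcosets H" for g c
      using that H by (auto simp: LCOSETS_def lcos_m_assoc[OF subgroup.subset[OF H]])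
    then have "(\<lambda>g. \<lambda>c\<in>lcosets H. inv g <# c) ` carrier G \<subseteq> lcosets H \<rightarrow>\<^sub>E lcosets H"
      by auto
    then show "finite ((\<lambda>g. \<lambda>c\<in>lcosets H. inv g <# c) ` carrier G)"
      using fin finite_PiE finite_subset by metis
  next
    fix g h assume g: "g \<in> carrier G" and h: "h \<in> carrier G"
      and eq: "(\<lambda>c\<in>lcosets H. inv g <# c) = (\<lambda>c\<in>lcosets H. inv h <# c)"
    have "inv a \<otimes> (inv g \<otimes> h) \<otimes> a \<in> H" if a: "a \<in> carrier G" for a
    proof -
      have b: "h \<otimes> a \<in> carrier G" using h a by simp
      have "inv g <# ((h \<otimes> a) <# H) = inv h <# ((h \<otimes> a) <# H)"
        using fun_cong[OF eq, of "(h \<otimes> a) <# H"] b l_coset_mem_lcosets by simp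
      then have "(inv g \<otimes> (h \<otimes> a)) <# H = (inv h \<otimes> (h \<otimes> a)) <# H"
        using g h a by (simp add: lcos_m_assoc[OF subgroup.subset[OF H]])
      then have "(inv g \<otimes> (h \<otimes> a)) <# H = a <# H"
        using g h a by (simp add: m_assoc[symmetric])
      then have "inv a \<otimes> (inv g \<otimes> (h \<otimes> a)) \<in> H"
        using l_coset_eq_iff[OF H, of a "inv g \<otimes> (h \<otimes> a)"] g h a by auto
      then show ?thesis using g h a by (simp add: m_assoc)
    qed
    then show "inv g \<otimes> h \<in> N" using g h by (simp add: N_def)
  qed
  ultimately show ?thesis using that by blast
qed

end

lemma (in group) finite_transversal:
  assumes "finite_index_subgroup G K"
  obtains R where "finite R" "R \<subseteq> carrier G" "\<And>g. g \<in> carrier G \<Longrightarrow> \<exists>r\<in>R. inv r \<otimes> g \<in> K"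
proof -
  have K: "subgroup K G" and fin: "finite (lcosets K)"
    using assms by (auto simp: finite_index_subgroup_def)
  have "lcosets K \<subseteq> (\<lambda>g. g <# K) ` carrier G" by (auto simp: LCOSETS_def)
  from finite_subset_image[OF fin this] obtain R
    where R: "R \<subseteq> carrier G" "finite R" "lcosets K = (\<lambda>g. g <# K) ` R" by blast
  have "\<exists>r\<in>R. inv r \<otimes> g \<in> K" if g: "g \<in> carrier G" for g
  proof -
    have "g <# K \<in> (\<lambda>g. g <# K) ` R" using l_coset_mem_lcosets[OF g, of K] R(3) by simp
    then obtain r where "r \<in> R" "r <# K = g <# K" by auto
    then show ?thesis using l_coset_eq_iff[OF K _ g] R(1) by blast
  qed
  then show ?thesis using that R by blast
qed

section \<open>The full shift\<close>

lemma topspace_full_shift: "topspace (full_shift G) = (carrier G \<rightarrow>\<^sub>E {0, 1})"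
  by (simp add: full_shift_def)

lemma compact_space_full_shift: "compact_space (full_shift G)"
  by (simp add: full_shift_def compact_space_product_topology compact_space_discrete_topology)

lemma metrizable_space_full_shift:
  assumes "countable (carrier G)"
  shows "metrizable_space (full_shift G)"
  using assms countable_subset[of _ "carrier G"]
  by (auto simp: full_shift_def metrizable_space_product_topology metrizable_space_discrete_topology)

lemma Hausdorff_space_full_shift: "Hausdorff_space (full_shift G)"
  by (simp add: full_shift_def Hausdorff_space_product_topology)

text \<open>Closeness in the full shift means agreement on a finite set of coordinates; this reduces
  the topological arguments below to finite sets \<open>F\<close>.\<close>

lemma openin_full_shift_iff:
  "openin (full_shift G) U \<longleftrightarrow> U \<subseteq> topspace (full_shift G) \<and>
     (\<forall>y\<in>U. \<exists>F. finite F \<and> F \<subseteq> carrier G \<and>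
        (\<forall>z\<in>topspace (full_shift G). (\<forall>h\<in>F. z h = y h) \<longrightarrow> z \<in> U))" (is "?L \<longleftrightarrow> ?R")
proof
  assume L: ?L
  show ?R
  proof (intro conjI ballI)
    show "U \<subseteq> topspace (full_shift G)" using L by (rule openin_subset)
    fix y assume y: "y \<in> U"
    obtain V where V: "finite {i \<in> carrier G. V i \<noteq> {0::nat,1}}" "y \<in> Pi\<^sub>E (carrier G) V" "Pi\<^sub>E (carrier G) V \<subseteq> U"
      using L y unfolding full_shift_def openin_product_topology_alt by auto
    let ?F = "{i \<in> carrier G. V i \<noteq> {0::nat,1}}"
    have "z \<in> U" if z: "z \<in> topspace (full_shift G)" "\<forall>h\<in>?F. z h = y h" for z
    proof -
      have "z i \<in> V i" if "i \<in> carrier G" for i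
        using that z V(2) by (cases "V i = {0,1}") (auto simp: topspace_full_shift PiE_iff)
      then have "z \<in> Pi\<^sub>E (carrier G) V"
        using z(1) by (auto simp: topspace_full_shift PiE_iff)
      then show ?thesis using V by blast
    qed
    with V(1) show "\<exists>F. finite F \<and> F \<subseteq> carrier G \<and>
        (\<forall>z\<in>topspace (full_shift G). (\<forall>h\<in>F. z h = y h) \<longrightarrow> z \<in> U)"
      by (intro exI[of _ ?F]) auto
  qed
next
  assume R: ?R
  show ?L
    unfolding full_shift_def openin_product_topology_alt
  proof
    fix y assume y: "y \<in> U"
    then obtain F where F: "finite F" "F \<subseteq> carrier G"
      "\<And>z. \<lbrakk>z \<in> topspace (full_shift G); \<forall>h\<in>F. z h = y h\<rbrakk> \<Longrightarrow> z \<in> U"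
      using R by meson
    have yt: "y \<in> carrier G \<rightarrow>\<^sub>E {0,1}" using R y unfolding topspace_full_shift by blast
    let ?V = "\<lambda>i. if i \<in> F then {y i} else {0,1}"
    have "{i \<in> carrier G. ?V i \<noteq> {0,1}} \<subseteq> F" by auto
    then have "finite {i \<in> carrier G. ?V i \<noteq> {0,1}}" by (rule finite_subset[OF _ F(1)])
    moreover have "\<forall>i\<in>carrier G. ?V i \<subseteq> {0,1}" using PiE_mem[OF yt] by simp
    moreover have "y \<in> Pi\<^sub>E (carrier G) ?V" using yt by (simp add: PiE_iff)
    moreover have "Pi\<^sub>E (carrier G) ?V \<subseteq> U"
    proof
      fix z assume z: "z \<in> Pi\<^sub>E (carrier G) ?V"
      have "z i \<in> {0,1}" if "i \<in> carrier G" for i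
        using PiE_mem[OF z that] PiE_mem[OF yt that] by (cases "i \<in> F") auto
      then have "z \<in> topspace (full_shift G)"
        using z by (auto simp: topspace_full_shift PiE_iff)
      moreover have "\<forall>h\<in>F. z h = y h"
        using PiE_mem[OF z] F(2) by fastforce
      ultimately show "z \<in> U" using F(3) by blast
    qed
    ultimately show "\<exists>V. finite {i \<in> carrier G. V i \<noteq> topspace (discrete_topology {0, 1})} \<and>
         (\<forall>i\<in>carrier G. openin (discrete_topology {0, 1}) (V i)) \<and> y \<in> Pi\<^sub>E (carrier G) V \<and> Pi\<^sub>E (carrier G) V \<subseteq> U"
      by (intro exI[of _ ?V]) simp
  qed
qed

definition cylinder :: "('g, 'm) monoid_scheme \<Rightarrow> 'g set \<Rightarrow> ('g \<Rightarrow> nat) \<Rightarrow> ('g \<Rightarrow> nat) set" where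
  "cylinder G F y = {z \<in> topspace (full_shift G). \<forall>h\<in>F. z h = y h}"

lemma openin_cylinder:
  assumes "finite F" "F \<subseteq> carrier G"
  shows "openin (full_shift G) (cylinder G F y)"
  using assms unfolding openin_full_shift_iff cylinder_def
  by (intro conjI ballI exI[of _ F]) auto

lemma closedin_cylinder:
  assumes "finite F" "F \<subseteq> carrier G"
  shows "closedin (full_shift G) (cylinder G F y)"
proof -
  have "openin (full_shift G) (topspace (full_shift G) - cylinder G F y)"
    using assms unfolding openin_full_shift_iff cylinder_def
    by (intro conjI ballI exI[of _ F]) simp_all
  then show ?thesis
    by (simp add: closedin_def cylinder_def)
qed

lemma in_closure_of_full_shift_iff:
  "y \<in> full_shift G closure_of S \<longleftrightarrow> y \<in> topspace (full_shift G) \<and>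
     (\<forall>F. finite F \<and> F \<subseteq> carrier G \<longrightarrow> S \<inter> cylinder G F y \<noteq> {})"
proof (cases "y \<in> topspace (full_shift G)")
  case True
  have "(\<forall>T. y \<in> T \<and> openin (full_shift G) T \<longrightarrow> (\<exists>s\<in>S. s \<in> T)) \<longleftrightarrow>
        (\<forall>F. finite F \<and> F \<subseteq> carrier G \<longrightarrow> S \<inter> cylinder G F y \<noteq> {})" (is "?L \<longleftrightarrow> ?R")
  proof
    assume L: ?L
    show ?R
    proof (intro allI impI)
      fix F assume F: "finite F \<and> F \<subseteq> carrier G"
      have "y \<in> cylinder G F y" using True by (simp add: cylinder_def)
      moreover have "openin (full_shift G) (cylinder G F y)" using F openin_cylinder by blast
      ultimately have "\<exists>s\<in>S. s \<in> cylinder G F y"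
        using L[rule_format, of "cylinder G F y"] by simp
      then show "S \<inter> cylinder G F y \<noteq> {}" by auto
    qed
  next
    assume R: ?R
    show ?L
    proof (intro allI impI)
      fix T assume T: "y \<in> T \<and> openin (full_shift G) T"
      then have "\<exists>F. finite F \<and> F \<subseteq> carrier G \<and>
          (\<forall>z\<in>topspace (full_shift G). (\<forall>h\<in>F. z h = y h) \<longrightarrow> z \<in> T)"
        by (simp add: openin_full_shift_iff)
      then obtain F where "finite F" "F \<subseteq> carrier G" "cylinder G F y \<subseteq> T"
        unfolding cylinder_def by (elim exE) auto
      then have "S \<inter> cylinder G F y \<noteq> {}" using R by simp
      then show "\<exists>s\<in>S. s \<in> T" using \<open>cylinder G F y \<subseteq> T\<close> by auto
    qed
  qed
  then show ?thesis using True by (simp add: in_closure_of Bex_def)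
qed (simp add: in_closure_of)

context group
begin

lemma shift_act_in_full_shift:
  "\<lbrakk>g \<in> carrier G; y \<in> topspace (full_shift G)\<rbrakk> \<Longrightarrow> shift_act G g y \<in> topspace (full_shift G)"
  by (auto simp: topspace_full_shift shift_act_def PiE_iff)

lemma shift_act_one: "y \<in> topspace (full_shift G) \<Longrightarrow> shift_act G \<one> y = y"
  by (auto simp: topspace_full_shift shift_act_def PiE_iff extensional_def restrict_def)

lemma shift_act_mult:
  "\<lbrakk>g \<in> carrier G; h \<in> carrier G\<rbrakk> \<Longrightarrow> shift_act G (g \<otimes> h) y = shift_act G g (shift_act G h y)"
  by (auto simp: shift_act_def restrict_def m_assoc)

lemma shift_act_inv_cancel:
  assumes "g \<in> carrier G" "y \<in> topspace (full_shift G)"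
  shows "shift_act G (inv g) (shift_act G g y) = y" "shift_act G g (shift_act G (inv g) y) = y"
  using assms shift_act_one by (simp_all flip: shift_act_mult)

lemma continuous_map_shift_act:
  assumes "g \<in> carrier G"
  shows "continuous_map (full_shift G) (full_shift G) (shift_act G g)"
  unfolding full_shift_def continuous_map_componentwise shift_act_def
  using assms by (auto intro: continuous_map_product_projection)

lemma shift_act_homeomorphic_map:
  assumes "g \<in> carrier G"
  shows "homeomorphic_map (full_shift G) (full_shift G) (shift_act G g)"
  using assms shift_act_inv_cancel continuous_map_shift_act
  by (intro homeomorphic_maps_imp_map[of _ _ _ "shift_act G (inv g)"])
     (simp add: homeomorphic_maps_def)

lemma shift_act_closure_of:
  assumes "g \<in> carrier G" "S \<subseteq> topspace (full_shift G)"
  shows "shift_act G g ` (full_shift G closure_of S) = full_shift G closure_of (shift_act G g ` S)"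
  using homeomorphic_map_closure_of[OF shift_act_homeomorphic_map[OF assms(1)] assms(2)] by simp

lemma topspace_orbit_closure:
  "topspace (orbit_closure G x) = full_shift G closure_of ((\<lambda>g. shift_act G g x) ` carrier G)"
  by (simp add: orbit_closure_def closure_of_subset_topspace Int_absorb1)

lemma orbit_closure_subset: "topspace (orbit_closure G x) \<subseteq> topspace (full_shift G)"
  by (simp add: topspace_orbit_closure closure_of_subset_topspace)

lemma orbit_in_orbit_closure:
  assumes "x \<in> topspace (full_shift G)" "g \<in> carrier G"
  shows "shift_act G g x \<in> topspace (orbit_closure G x)"
proof -
  have "(\<lambda>g. shift_act G g x) ` carrier G \<subseteq> topspace (full_shift G)"
    using assms shift_act_in_full_shift by auto
  from closure_of_subset[OF this] show ?thesis
    using assms(2) by (auto simp: topspace_orbit_closure)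
qed

lemma self_in_orbit_closure:
  "x \<in> topspace (full_shift G) \<Longrightarrow> x \<in> topspace (orbit_closure G x)"
  using orbit_in_orbit_closure[of x "\<one>"] shift_act_one by simp

lemma shift_act_orbit_closure:
  assumes x: "x \<in> topspace (full_shift G)" and g: "g \<in> carrier G"
  shows "shift_act G g ` topspace (orbit_closure G x) \<subseteq> topspace (orbit_closure G x)"
proof -
  have "shift_act G g ` (\<lambda>g. shift_act G g x) ` carrier G \<subseteq> (\<lambda>g. shift_act G g x) ` carrier G"
    using g by (auto simp flip: shift_act_mult)
  then show ?thesis
    using x g shift_act_in_full_shift unfolding topspace_orbit_closure
    by (subst shift_act_closure_of) (auto intro!: closure_of_mono)
qed

lemma Hausdorff_space_orbit_closure: "Hausdorff_space (orbit_closure G x)"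
  by (simp add: orbit_closure_def Hausdorff_space_full_shift Hausdorff_space_subtopology)

lemma dynamical_system_orbit_closure:
  assumes x: "x \<in> topspace (full_shift G)" and count: "countable (carrier G)"
  shows "dynamical_system G (orbit_closure G x) (shift_act G)"
  unfolding dynamical_system_def
proof (intro conjI ballI)
  show "compact_space (orbit_closure G x)"
    unfolding orbit_closure_def
    by (intro compact_space_subtopology closedin_compact_space compact_space_full_shift closedin_closure_of)
  show "metrizable_space (orbit_closure G x)"
    using metrizable_space_full_shift[OF count]
    by (simp add: orbit_closure_def metrizable_space_subtopology)
next
  fix g assume g: "g \<in> carrier G"
  have "continuous_map (orbit_closure G x) (full_shift G) (shift_act G g)"
    unfolding orbit_closure_def using g
    by (intro continuous_map_from_subtopology continuous_map_shift_act)
  then show "continuous_map (orbit_closure G x) (orbit_closure G x) (shift_act G g)"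
    using shift_act_orbit_closure[OF x g]
    by (subst (2) orbit_closure_def) (auto simp: continuous_map_in_subtopology topspace_orbit_closure)
next
  fix y assume "y \<in> topspace (orbit_closure G x)"
  then show "shift_act G \<one> y = y"
    using orbit_closure_subset shift_act_one by blast
qed (simp add: shift_act_mult)

lemma openin_orbit_closure_cylinder:
  assumes "openin (orbit_closure G x) U" "z \<in> U"
  obtains F where "finite F" "F \<subseteq> carrier G" "cylinder G F z \<inter> topspace (orbit_closure G x) \<subseteq> U"
proof -
  obtain T where T: "openin (full_shift G) T" "U = T \<inter> topspace (orbit_closure G x)"
    using assms(1) unfolding orbit_closure_def openin_subtopology
    by (auto simp: closure_of_subset_topspace Int_absorb1)
  then have "\<exists>F. finite F \<and> F \<subseteq> carrier G \<and>
      (\<forall>w\<in>topspace (full_shift G). (\<forall>h\<in>F. w h = z h) \<longrightarrow> w \<in> T)"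
    using assms(2) by (simp add: openin_full_shift_iff)
  then obtain F where "finite F" "F \<subseteq> carrier G" "cylinder G F z \<subseteq> T"
    unfolding cylinder_def by (elim exE) auto
  then show ?thesis using that T(2) by blast
qed

end

section \<open>Odometers of normal subgroups\<close>

locale normal_odometer = group G for G (structure) +
  fixes \<Gamma> :: "nat \<Rightarrow> 'a set"
  assumes sequence: "odometer_sequence G \<Gamma>"
    and normal: "\<And>n. \<Gamma> n \<lhd> G"
begin

abbreviation \<O> where "\<O> \<equiv> odometer_group G \<Gamma>"
abbreviation \<tau> where "\<tau> \<equiv> odometer_tau G \<Gamma>"

lemma subgroup_\<Gamma>: "subgroup (\<Gamma> n) G"
  using normal by (simp add: normal_imp_subgroup)

lemma \<Gamma>_antimono: "m \<le> n \<Longrightarrow> \<Gamma> n \<subseteq> \<Gamma> m"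
  using sequence lift_Suc_antimono_le[of \<Gamma>] unfolding odometer_sequence_def by blast

lemma coset_eq_antimono:
  assumes "g \<in> carrier G" "h \<in> carrier G" "g <# \<Gamma> n = h <# \<Gamma> n" "m \<le> n"
  shows "g <# \<Gamma> m = h <# \<Gamma> m"
  using assms \<Gamma>_antimono[OF assms(4)] by (auto simp: l_coset_eq_iff[OF subgroup_\<Gamma>])

lemma coset_mult:
  assumes "g \<in> carrier G" "h \<in> carrier G"
  shows "(g <# \<Gamma> n) <#> (h <# \<Gamma> n) = (g \<otimes> h) <# \<Gamma> n"
  using assms normal.coset_eq[OF normal] normal.rcos_sum[OF normal] by (metis m_closed)

lemma coset_act:
  "\<lbrakk>g \<in> carrier G; h \<in> carrier G\<rbrakk> \<Longrightarrow> g <# (h <# \<Gamma> n) = (g \<otimes> h) <# \<Gamma> n"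
  using lcos_m_assoc subgroup.subset[OF subgroup_\<Gamma>] by blast

lemma coset_eq_\<Gamma>_iff:
  assumes "g \<in> carrier G" shows "g <# \<Gamma> n = \<Gamma> n \<longleftrightarrow> g \<in> \<Gamma> n"
proof -
  have "\<Gamma> n = \<one> <# \<Gamma> n"
    by (simp add: lcos_mult_one subgroup.subset[OF subgroup_\<Gamma>])
  moreover have "\<one> <# \<Gamma> n = g <# \<Gamma> n \<longleftrightarrow> g \<in> \<Gamma> n"
    using l_coset_eq_iff[OF subgroup_\<Gamma>, of \<one> g n] assms by simp
  ultimately show ?thesis by metis
qed

text \<open>The compatibility of neighbouring levels propagates downwards, so all levels up to \<open>n\<close> have a
  common representative. Every computation with points of the odometer is made at one level with
  such a representative.\<close>

lemma odometer_set_iff: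
  "\<xi> \<in> odometer_set G \<Gamma> \<longleftrightarrow> (\<forall>n. \<exists>g\<in>carrier G. \<forall>m\<le>n. \<xi> m = g <# \<Gamma> m)"
proof
  assume "\<xi> \<in> odometer_set G \<Gamma>"
  then obtain g where \<xi>: "\<xi> = (\<lambda>n. g n <# \<Gamma> n)" and g: "\<And>n. g n \<in> carrier G"
    and step: "\<And>n. g (Suc n) <# \<Gamma> n = g n <# \<Gamma> n"
    unfolding odometer_set_def by blast
  have "g n <# \<Gamma> m = g m <# \<Gamma> m" if "m \<le> n" for m n
    using that
  proof (induction n rule: dec_induct)
    case (step n)
    then show ?case
      using \<open>g (Suc n) <# \<Gamma> n = g n <# \<Gamma> n\<close> coset_eq_antimono[OF g g] by metis
  qed simp
  then show "\<forall>n. \<exists>h\<in>carrier G. \<forall>m\<le>n. \<xi> m = h <# \<Gamma> m"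
    using \<xi> g by metis
next
  assume "\<forall>n. \<exists>g\<in>carrier G. \<forall>m\<le>n. \<xi> m = g <# \<Gamma> m"
  then obtain g where g: "\<And>n. g n \<in> carrier G" "\<And>n m. m \<le> n \<Longrightarrow> \<xi> m = g n <# \<Gamma> m"
    by metis
  have "\<xi> = (\<lambda>n. g n <# \<Gamma> n)"
    using g(2) by blast
  moreover have "g (Suc n) <# \<Gamma> n = g n <# \<Gamma> n" for n
    using g(2)[of n n] g(2)[of n "Suc n"] by simp
  ultimately show "\<xi> \<in> odometer_set G \<Gamma>"
    using g(1) unfolding odometer_set_def by blast
qed

lemma odometer_point_rep:
  assumes "\<xi> \<in> odometer_set G \<Gamma>"
  obtains g where "g \<in> carrier G" "\<And>m. m \<le> n \<Longrightarrow> \<xi> m = g <# \<Gamma> m"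
  using assms unfolding odometer_set_iff by blast

lemma odometer_coord_rep:
  assumes "\<xi> \<in> odometer_set G \<Gamma>"
  obtains g where "g \<in> carrier G" "\<xi> n = g <# \<Gamma> n"
  using odometer_point_rep[OF assms, of n] by (metis order_refl)

lemma odometer_coord_antimono:
  assumes "\<xi> \<in> odometer_set G \<Gamma>" "\<eta> \<in> odometer_set G \<Gamma>" "\<xi> n = \<eta> n" "m \<le> n"
  shows "\<xi> m = \<eta> m"
proof -
  obtain g where "g \<in> carrier G" "\<And>m. m \<le> n \<Longrightarrow> \<xi> m = g <# \<Gamma> m"
    using odometer_point_rep[OF assms(1)] by blast
  moreover obtain h where "h \<in> carrier G" "\<And>m. m \<le> n \<Longrightarrow> \<eta> m = h <# \<Gamma> m"
    using odometer_point_rep[OF assms(2)] by blast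
  ultimately show ?thesis
    using coset_eq_antimono assms(3,4) by (metis order_refl)
qed

lemma topspace_odometer: "topspace (odometer G \<Gamma>) = odometer_set G \<Gamma>"
proof -
  have "\<xi> n \<in> lcosets (\<Gamma> n)" if "\<xi> \<in> odometer_set G \<Gamma>" for \<xi> n
    using odometer_coord_rep[OF that] l_coset_mem_lcosets by metis
  then show ?thesis
    by (auto simp: odometer_def)
qed

text \<open>A coordinate determines all lower ones, so fixing finitely many coordinates amounts to fixing
  the highest of them, and a single coordinate suffices to describe a neighbourhood.\<close>

lemma openin_odometer_iff:
  "openin (odometer G \<Gamma>) U \<longleftrightarrow> U \<subseteq> odometer_set G \<Gamma> \<and>
     (\<forall>\<xi>\<in>U. \<exists>n. \<forall>\<eta>\<in>odometer_set G \<Gamma>. \<eta> n = \<xi> n \<longrightarrow> \<eta> \<in> U)" (is "?L \<longleftrightarrow> ?R")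
proof
  assume L: ?L
  show ?R
  proof (intro conjI ballI)
    show sub: "U \<subseteq> odometer_set G \<Gamma>" using openin_subset[OF L] by (simp add: topspace_odometer)
    fix \<xi> assume \<xi>: "\<xi> \<in> U"
    obtain T where T: "openin (product_topology (\<lambda>n. discrete_topology (lcosets (\<Gamma> n))) UNIV) T"
      "U = T \<inter> odometer_set G \<Gamma>"
      using L unfolding odometer_def openin_subtopology by blast
    obtain V where V: "finite {i. V i \<noteq> lcosets (\<Gamma> i)}" "\<xi> \<in> Pi\<^sub>E UNIV V" "Pi\<^sub>E UNIV V \<subseteq> T"
      using T \<xi> unfolding openin_product_topology_alt by auto
    obtain n where n: "\<And>i. V i \<noteq> lcosets (\<Gamma> i) \<Longrightarrow> i \<le> n"
      using V(1) unfolding finite_nat_set_iff_bounded_le by blast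
    have "\<eta> \<in> U" if \<eta>: "\<eta> \<in> odometer_set G \<Gamma>" "\<eta> n = \<xi> n" for \<eta>
    proof -
      have "\<eta> i \<in> V i" for i
      proof (cases "i \<le> n")
        case True
        then have "\<eta> i = \<xi> i" using odometer_coord_antimono \<eta> \<xi> sub by blast
        then show ?thesis using V(2) by (auto simp: PiE_iff)
      next
        case False
        then have "V i = lcosets (\<Gamma> i)" using n by blast
        then show ?thesis
          using odometer_coord_rep[OF \<eta>(1)] l_coset_mem_lcosets by metis
      qed
      then have "\<eta> \<in> T" using V(3) by (auto simp: PiE_iff)
      then show ?thesis using T \<eta> by blast
    qed
    then show "\<exists>n. \<forall>\<eta>\<in>odometer_set G \<Gamma>. \<eta> n = \<xi> n \<longrightarrow> \<eta> \<in> U" by blast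
  qed
next
  assume R: ?R
  show ?L
  proof (subst openin_subopen, intro ballI)
    fix \<xi> assume \<xi>: "\<xi> \<in> U"
    then obtain n where n: "\<And>\<eta>. \<lbrakk>\<eta> \<in> odometer_set G \<Gamma>; \<eta> n = \<xi> n\<rbrakk> \<Longrightarrow> \<eta> \<in> U" using R by blast
    have \<xi>O: "\<xi> \<in> odometer_set G \<Gamma>" using R \<xi> by blast
    then have c: "\<xi> n \<in> lcosets (\<Gamma> n)"
      using odometer_coord_rep[of \<xi>] l_coset_mem_lcosets by metis
    have "continuous_map (odometer G \<Gamma>) (discrete_topology (lcosets (\<Gamma> n))) (\<lambda>\<eta>. \<eta> n)"
      unfolding odometer_def
      by (intro continuous_map_from_subtopology)
         (rule continuous_map_product_projection[where X = "\<lambda>n. discrete_topology (lcosets (\<Gamma> n))"], simp)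
    from openin_continuous_map_preimage[OF this, of "{\<xi> n}"] c
    have "openin (odometer G \<Gamma>) {\<eta> \<in> odometer_set G \<Gamma>. \<eta> n = \<xi> n}"
      by (simp add: topspace_odometer)
    then show "\<exists>T. openin (odometer G \<Gamma>) T \<and> \<xi> \<in> T \<and> T \<subseteq> U"
      using n \<xi>O by (intro exI[of _ "{\<eta> \<in> odometer_set G \<Gamma>. \<eta> n = \<xi> n}"]) auto
  qed
qed

lemma openin_odometer_nbhd:
  assumes "openin (odometer G \<Gamma>) U" "\<xi> \<in> U"
  obtains n where "\<forall>\<eta>\<in>odometer_set G \<Gamma>. \<eta> n = \<xi> n \<longrightarrow> \<eta> \<in> U"
  using assms by (auto simp: openin_odometer_iff)

text \<open>Incompatibility of a sequence of cosets is visible in two neighbouring coordinates, so it is an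
  open condition.\<close>

lemma closedin_odometer_set:
  "closedin (product_topology (\<lambda>n. discrete_topology (lcosets (\<Gamma> n))) UNIV) (odometer_set G \<Gamma>)"
    (is "closedin ?P _")
  unfolding closedin_def
proof
  show "odometer_set G \<Gamma> \<subseteq> topspace ?P"
    using topspace_odometer unfolding odometer_def by auto
  show "openin ?P (topspace ?P - odometer_set G \<Gamma>)"
  proof (subst openin_subopen, intro ballI)
    fix f assume f: "f \<in> topspace ?P - odometer_set G \<Gamma>"
    have fc: "f n \<in> lcosets (\<Gamma> n)" for n using f by (auto simp: PiE_iff)
    then have "\<forall>n. \<exists>g\<in>carrier G. f n = g <# \<Gamma> n" by (auto simp: LCOSETS_def)
    then obtain g where g: "\<And>n. g n \<in> carrier G" "f = (\<lambda>n. g n <# \<Gamma> n)" by metis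
    then obtain n where n: "g (Suc n) <# \<Gamma> n \<noteq> g n <# \<Gamma> n"
      using f unfolding odometer_set_def by blast
    have op: "openin ?P {h \<in> topspace ?P. h k \<in> {f k}}" for k
    proof (rule openin_continuous_map_preimage)
      show "continuous_map ?P (discrete_topology (lcosets (\<Gamma> k))) (\<lambda>h. h k)"
        by (rule continuous_map_product_projection[where X = "\<lambda>n. discrete_topology (lcosets (\<Gamma> n))"]) simp
      show "openin (discrete_topology (lcosets (\<Gamma> k))) {f k}" using fc by simp
    qed
    have "h \<notin> odometer_set G \<Gamma>" if "h n = f n" "h (Suc n) = f (Suc n)" for h
    proof
      assume "h \<in> odometer_set G \<Gamma>"
      then obtain a where a: "a \<in> carrier G" "\<And>m. m \<le> Suc n \<Longrightarrow> h m = a <# \<Gamma> m"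
        using odometer_point_rep by blast
      have "a <# \<Gamma> n = g n <# \<Gamma> n" "a <# \<Gamma> (Suc n) = g (Suc n) <# \<Gamma> (Suc n)"
        using a(2)[of n] a(2)[of "Suc n"] that g(2) by auto
      then show False
        using coset_eq_antimono[OF a(1) g(1), of "Suc n" "Suc n" n] n by simp
    qed
    then show "\<exists>T. openin ?P T \<and> f \<in> T \<and> T \<subseteq> topspace ?P - odometer_set G \<Gamma>"
      using openin_Int[OF op[of n] op[of "Suc n"]] f
      by (intro exI[of _ "{h \<in> topspace ?P. h n \<in> {f n}} \<inter> {h \<in> topspace ?P. h (Suc n) \<in> {f (Suc n)}}"]) auto
  qed
qed

lemma compact_space_odometer: "compact_space (odometer G \<Gamma>)"
proof -
  have "compact_space (product_topology (\<lambda>n. discrete_topology (lcosets (\<Gamma> n))) UNIV)"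
    using sequence by (simp add: compact_space_product_topology compact_space_discrete_topology
        odometer_sequence_def finite_index_subgroup_def)
  then show ?thesis
    unfolding odometer_def
    by (intro compact_space_subtopology closedin_compact_space closedin_odometer_set)
qed

text \<open>The ultrametric given by the first level of disagreement. Left multiplication by an element of
  \<open>G\<close> preserves agreement at each level, so it acts by isometries, which makes the odometer
  equicontinuous.\<close>

definition odometer_dist :: "(nat \<Rightarrow> 'a set) \<Rightarrow> (nat \<Rightarrow> 'a set) \<Rightarrow> real" where
  "odometer_dist \<xi> \<eta> = (if \<xi> = \<eta> then 0 else 1 / real (Suc (LEAST n. \<xi> n \<noteq> \<eta> n)))"

lemma odometer_dist_less_iff:
  assumes "\<xi> \<in> odometer_set G \<Gamma>" "\<eta> \<in> odometer_set G \<Gamma>"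
  shows "odometer_dist \<xi> \<eta> < 1 / real (Suc n) \<longleftrightarrow> \<xi> n = \<eta> n"
proof (cases "\<xi> = \<eta>")
  case True
  then show ?thesis by (simp add: odometer_dist_def)
next
  case False
  define L where "L = (LEAST n. \<xi> n \<noteq> \<eta> n)"
  have L: "\<xi> L \<noteq> \<eta> L"
    using False LeastI_ex[of "\<lambda>n. \<xi> n \<noteq> \<eta> n"] unfolding L_def by blast
  have "odometer_dist \<xi> \<eta> < 1 / real (Suc n) \<longleftrightarrow> n < L"
    using False by (simp add: odometer_dist_def L_def[symmetric] divide_simps)
  also have "\<dots> \<longleftrightarrow> \<xi> n = \<eta> n"
    using L not_less_Least[of n "\<lambda>n. \<xi> n \<noteq> \<eta> n"] odometer_coord_antimono[OF assms]
    unfolding L_def by (meson linorder_not_le)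
  finally show ?thesis .
qed

lemma Metric_space_odometer: "Metric_space (odometer_set G \<Gamma>) odometer_dist"
proof
  show "0 \<le> odometer_dist \<xi> \<eta>" for \<xi> \<eta> by (simp add: odometer_dist_def)
  show "odometer_dist \<xi> \<eta> = odometer_dist \<eta> \<xi>" for \<xi> \<eta>
    by (simp add: odometer_dist_def eq_commute)
  show "odometer_dist \<xi> \<eta> = 0 \<longleftrightarrow> \<xi> = \<eta>" for \<xi> \<eta> by (simp add: odometer_dist_def)
next
  fix \<xi> \<eta> \<zeta> assume O: "\<xi> \<in> odometer_set G \<Gamma>" "\<eta> \<in> odometer_set G \<Gamma>" "\<zeta> \<in> odometer_set G \<Gamma>"
  have nn: "0 \<le> odometer_dist \<xi> \<eta>" for \<xi> \<eta> by (simp add: odometer_dist_def)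
  show "odometer_dist \<xi> \<zeta> \<le> odometer_dist \<xi> \<eta> + odometer_dist \<eta> \<zeta>"
  proof (cases "\<xi> = \<zeta>")
    case True
    then show ?thesis using nn by (simp add: odometer_dist_def)
  next
    case False
    define L where "L = (LEAST n. \<xi> n \<noteq> \<zeta> n)"
    have "\<xi> L \<noteq> \<zeta> L"
      using False LeastI_ex[of "\<lambda>n. \<xi> n \<noteq> \<zeta> n"] unfolding L_def by blast
    then consider "\<xi> L \<noteq> \<eta> L" | "\<eta> L \<noteq> \<zeta> L" by metis
    then have "1 / real (Suc L) \<le> odometer_dist \<xi> \<eta> \<or> 1 / real (Suc L) \<le> odometer_dist \<eta> \<zeta>"
      using odometer_dist_less_iff O by (metis linorder_not_le)
    moreover have "odometer_dist \<xi> \<zeta> = 1 / real (Suc L)"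
      using False by (simp add: odometer_dist_def L_def)
    ultimately show ?thesis using nn[of \<xi> \<eta>] nn[of \<eta> \<zeta>] by linarith
  qed
qed

lemma mtopology_odometer:
  "Metric_space.mtopology (odometer_set G \<Gamma>) odometer_dist = odometer G \<Gamma>"
proof -
  interpret M: Metric_space "odometer_set G \<Gamma>" odometer_dist by (rule Metric_space_odometer)
  have "openin M.mtopology U \<longleftrightarrow> openin (odometer G \<Gamma>) U" for U
  proof -
    have "(\<exists>r>0. M.mball \<xi> r \<subseteq> U) \<longleftrightarrow>
          (\<exists>n. \<forall>\<eta>\<in>odometer_set G \<Gamma>. \<eta> n = \<xi> n \<longrightarrow> \<eta> \<in> U)" if \<xi>: "\<xi> \<in> odometer_set G \<Gamma>" for \<xi>
    proof
      assume "\<exists>r>0. M.mball \<xi> r \<subseteq> U"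
      then obtain r where r: "r > 0" "M.mball \<xi> r \<subseteq> U" by blast
      obtain n where n: "1 / real (Suc n) < r" using r(1) nat_approx_posE by blast
      have "\<eta> \<in> U" if "\<eta> \<in> odometer_set G \<Gamma>" "\<eta> n = \<xi> n" for \<eta>
      proof -
        have "odometer_dist \<xi> \<eta> < r"
          using odometer_dist_less_iff[OF \<xi> that(1), of n] that(2) n by simp
        then show ?thesis using r(2) \<xi> that(1) by (auto simp: M.in_mball subset_iff)
      qed
      then show "\<exists>n. \<forall>\<eta>\<in>odometer_set G \<Gamma>. \<eta> n = \<xi> n \<longrightarrow> \<eta> \<in> U" by blast
    next
      assume "\<exists>n. \<forall>\<eta>\<in>odometer_set G \<Gamma>. \<eta> n = \<xi> n \<longrightarrow> \<eta> \<in> U"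
      then obtain n where "\<forall>\<eta>\<in>odometer_set G \<Gamma>. \<eta> n = \<xi> n \<longrightarrow> \<eta> \<in> U" by blast
      then have "M.mball \<xi> (1 / real (Suc n)) \<subseteq> U"
        using odometer_dist_less_iff[OF \<xi>, of _ n] by (auto simp: M.in_mball simp del: of_nat_Suc)
      then show "\<exists>r>0. M.mball \<xi> r \<subseteq> U"
        by (intro exI[of _ "1 / real (Suc n)"]) simp
    qed
    then show ?thesis
      unfolding M.openin_mtopology openin_odometer_iff by blast
  qed
  then show ?thesis by (simp add: topology_eq)
qed

lemma Hausdorff_space_odometer: "Hausdorff_space (odometer G \<Gamma>)"
  using Metric_space.Hausdorff_space_mtopology[OF Metric_space_odometer]
  by (simp add: mtopology_odometer)

lemma odometer_act_coset:
  assumes "g \<in> carrier G" "h \<in> carrier G" "\<xi> n = h <# \<Gamma> n"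
  shows "odometer_act G g \<xi> n = (g \<otimes> h) <# \<Gamma> n"
  using assms by (simp add: odometer_act_def coset_act)

lemma odometer_act_in:
  assumes "g \<in> carrier G" "\<xi> \<in> odometer_set G \<Gamma>"
  shows "odometer_act G g \<xi> \<in> odometer_set G \<Gamma>"
  unfolding odometer_set_iff
proof
  fix n
  obtain h where h: "h \<in> carrier G" "\<And>m. m \<le> n \<Longrightarrow> \<xi> m = h <# \<Gamma> m"
    using odometer_point_rep[OF assms(2)] by blast
  then show "\<exists>k\<in>carrier G. \<forall>m\<le>n. odometer_act G g \<xi> m = k <# \<Gamma> m"
    using odometer_act_coset assms(1) by (intro bexI[of _ "g \<otimes> h"]) auto
qed

lemma odometer_act_one: "\<xi> \<in> odometer_set G \<Gamma> \<Longrightarrow> odometer_act G \<one> \<xi> = \<xi>"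
proof
  fix n assume "\<xi> \<in> odometer_set G \<Gamma>"
  then obtain h where "h \<in> carrier G" "\<xi> n = h <# \<Gamma> n"
    using odometer_coord_rep by blast
  then show "odometer_act G \<one> \<xi> n = \<xi> n"
    using odometer_act_coset[of \<one> h \<xi> n] by simp
qed

lemma odometer_act_mult:
  assumes "g \<in> carrier G" "h \<in> carrier G" "\<xi> \<in> odometer_set G \<Gamma>"
  shows "odometer_act G (g \<otimes> h) \<xi> = odometer_act G g (odometer_act G h \<xi>)"
proof
  fix n
  obtain k where "k \<in> carrier G" "\<xi> n = k <# \<Gamma> n"
    using odometer_coord_rep[OF assms(3)] by blast
  then show "odometer_act G (g \<otimes> h) \<xi> n = odometer_act G g (odometer_act G h \<xi>) n"
    using assms by (simp add: odometer_act_def coset_act m_assoc)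
qed

text \<open>Such a map preserves agreement at each level. This applies both to the action of \<open>G\<close> and to
  the translations of the group \<open>\<O>\<close>.\<close>

lemma continuous_map_odometer:
  assumes "\<And>\<xi>. \<xi> \<in> odometer_set G \<Gamma> \<Longrightarrow> f \<xi> \<in> odometer_set G \<Gamma>"
    and "\<And>\<xi> \<eta> n. \<lbrakk>\<xi> \<in> odometer_set G \<Gamma>; \<eta> \<in> odometer_set G \<Gamma>; \<xi> n = \<eta> n\<rbrakk> \<Longrightarrow> f \<xi> n = f \<eta> n"
  shows "continuous_map (odometer G \<Gamma>) (odometer G \<Gamma>) f"
  unfolding continuous_map_def topspace_odometer
proof (intro conjI allI impI)
  show "f \<in> odometer_set G \<Gamma> \<rightarrow> odometer_set G \<Gamma>" using assms(1) by blast
  fix U assume U: "openin (odometer G \<Gamma>) U"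
  show "openin (odometer G \<Gamma>) {\<xi> \<in> odometer_set G \<Gamma>. f \<xi> \<in> U}"
    unfolding openin_odometer_iff
  proof (intro conjI ballI)
    fix \<xi> assume \<xi>: "\<xi> \<in> {\<xi> \<in> odometer_set G \<Gamma>. f \<xi> \<in> U}"
    then obtain n where "\<forall>\<eta>\<in>odometer_set G \<Gamma>. \<eta> n = f \<xi> n \<longrightarrow> \<eta> \<in> U"
      using U unfolding openin_odometer_iff by blast
    then have "\<eta> \<in> {\<xi> \<in> odometer_set G \<Gamma>. f \<xi> \<in> U}"
      if "\<eta> \<in> odometer_set G \<Gamma>" "\<eta> n = \<xi> n" for \<eta>
      using that \<xi> assms(1)[of \<eta>] assms(2)[of \<eta> \<xi> n] by blast
    then show "\<exists>n. \<forall>\<eta>\<in>odometer_set G \<Gamma>. \<eta> n = \<xi> n \<longrightarrow> \<eta> \<in> {\<xi> \<in> odometer_set G \<Gamma>. f \<xi> \<in> U}"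
      by blast
  qed auto
qed

lemma dynamical_system_odometer: "dynamical_system G (odometer G \<Gamma>) (odometer_act G)"
  unfolding dynamical_system_def topspace_odometer
proof (intro conjI ballI)
  show "metrizable_space (odometer G \<Gamma>)"
    using Metric_space.metrizable_space_mtopology[OF Metric_space_odometer]
    by (simp add: mtopology_odometer)
  show "continuous_map (odometer G \<Gamma>) (odometer G \<Gamma>) (odometer_act G g)" if "g \<in> carrier G" for g
    using that by (intro continuous_map_odometer odometer_act_in) (auto simp: odometer_act_def)
qed (use compact_space_odometer odometer_act_one odometer_act_mult in auto)

lemma equicontinuous_system_odometer: "equicontinuous_system G (odometer G \<Gamma>) (odometer_act G)"
  unfolding equicontinuous_system_def topspace_odometer
proof (intro conjI exI[of _ odometer_dist] allI impI)
  fix \<epsilon> :: real assume "\<epsilon> > 0"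
  then obtain n where n: "1 / real (Suc n) < \<epsilon>" using nat_approx_posE by blast
  have "odometer_dist (odometer_act G g \<xi>) (odometer_act G g \<eta>) < \<epsilon>"
    if "\<xi> \<in> odometer_set G \<Gamma>" "\<eta> \<in> odometer_set G \<Gamma>" "odometer_dist \<xi> \<eta> < 1 / real (Suc n)"
      "g \<in> carrier G" for \<xi> \<eta> g
  proof -
    have "\<xi> n = \<eta> n" using odometer_dist_less_iff that by blast
    then have "odometer_act G g \<xi> n = odometer_act G g \<eta> n" by (simp add: odometer_act_def)
    then have "odometer_dist (odometer_act G g \<xi>) (odometer_act G g \<eta>) < 1 / real (Suc n)"
      using odometer_dist_less_iff odometer_act_in that by blast
    then show ?thesis using n by linarith
  qed
  then show "\<exists>\<delta>>0. \<forall>\<xi>\<in>odometer_set G \<Gamma>. \<forall>\<eta>\<in>odometer_set G \<Gamma>. odometer_dist \<xi> \<eta> < \<delta> \<longrightarrow>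
      (\<forall>g\<in>carrier G. odometer_dist (odometer_act G g \<xi>) (odometer_act G g \<eta>) < \<epsilon>)"
    by (intro exI[of _ "1 / real (Suc n)"]) simp
qed (simp_all add: dynamical_system_odometer Metric_space_odometer mtopology_odometer)

lemma one_in_odometer: "\<Gamma> \<in> odometer_set G \<Gamma>"
  unfolding odometer_set_iff
  by (auto intro!: bexI[of _ \<one>] simp: lcos_mult_one subgroup.subset[OF subgroup_\<Gamma>])

lemma \<tau>_eq_act: "\<tau> g = odometer_act G g \<Gamma>"
  by (simp add: odometer_tau_def odometer_act_def)

lemma \<tau>_in: "g \<in> carrier G \<Longrightarrow> \<tau> g \<in> odometer_set G \<Gamma>"
  by (simp add: \<tau>_eq_act odometer_act_in one_in_odometer)

lemma \<tau>_mult: "\<lbrakk>g \<in> carrier G; h \<in> carrier G\<rbrakk> \<Longrightarrow> \<tau> (g \<otimes> h) = odometer_act G g (\<tau> h)"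
  by (simp add: \<tau>_eq_act odometer_act_mult one_in_odometer)

lemma \<tau>_dense:
  assumes "openin (odometer G \<Gamma>) U" "U \<noteq> {}"
  obtains g where "g \<in> carrier G" "\<tau> g \<in> U"
proof -
  obtain \<xi> where \<xi>: "\<xi> \<in> U" using assms(2) by blast
  obtain n where n: "\<forall>\<eta>\<in>odometer_set G \<Gamma>. \<eta> n = \<xi> n \<longrightarrow> \<eta> \<in> U"
    using assms(1) \<xi> unfolding openin_odometer_iff by blast
  have "\<xi> \<in> odometer_set G \<Gamma>" using assms(1) \<xi> unfolding openin_odometer_iff by blast
  then obtain g where "g \<in> carrier G" "\<xi> n = g <# \<Gamma> n"
    using odometer_coord_rep by blast
  then show ?thesis using that[of g] n \<tau>_in by (auto simp: odometer_tau_def)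
qed

lemma carrier_odometer_group [simp]: "carrier \<O> = odometer_set G \<Gamma>"
  and one_odometer_group [simp]: "\<one>\<^bsub>\<O>\<^esub> = \<Gamma>"
  and mult_odometer_group: "\<xi> \<otimes>\<^bsub>\<O>\<^esub> \<eta> = (\<lambda>n. \<xi> n <#> \<eta> n)"
  by (simp_all add: odometer_group_def)

lemma odometer_mult_coset:
  assumes "g \<in> carrier G" "h \<in> carrier G" "\<xi> n = g <# \<Gamma> n" "\<eta> n = h <# \<Gamma> n"
  shows "(\<xi> \<otimes>\<^bsub>\<O>\<^esub> \<eta>) n = (g \<otimes> h) <# \<Gamma> n"
  using assms by (simp add: mult_odometer_group coset_mult)

lemma odometer_mult_in:
  assumes "\<xi> \<in> odometer_set G \<Gamma>" "\<eta> \<in> odometer_set G \<Gamma>"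
  shows "\<xi> \<otimes>\<^bsub>\<O>\<^esub> \<eta> \<in> odometer_set G \<Gamma>"
  unfolding odometer_set_iff
proof
  fix n
  obtain g where "g \<in> carrier G" "\<And>m. m \<le> n \<Longrightarrow> \<xi> m = g <# \<Gamma> m"
    using odometer_point_rep[OF assms(1)] by blast
  moreover obtain h where "h \<in> carrier G" "\<And>m. m \<le> n \<Longrightarrow> \<eta> m = h <# \<Gamma> m"
    using odometer_point_rep[OF assms(2)] by blast
  ultimately show "\<exists>k\<in>carrier G. \<forall>m\<le>n. (\<xi> \<otimes>\<^bsub>\<O>\<^esub> \<eta>) m = k <# \<Gamma> m"
    using odometer_mult_coset by (intro bexI[of _ "g \<otimes> h"]) auto
qed

lemma group_odometer_group: "group \<O>"
proof (rule groupI)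
  fix \<xi> \<eta> \<zeta> assume "\<xi> \<in> carrier \<O>" "\<eta> \<in> carrier \<O>" "\<zeta> \<in> carrier \<O>"
  then have O: "\<xi> \<in> odometer_set G \<Gamma>" "\<eta> \<in> odometer_set G \<Gamma>" "\<zeta> \<in> odometer_set G \<Gamma>" by simp_all
  show "\<xi> \<otimes>\<^bsub>\<O>\<^esub> \<eta> \<otimes>\<^bsub>\<O>\<^esub> \<zeta> = \<xi> \<otimes>\<^bsub>\<O>\<^esub> (\<eta> \<otimes>\<^bsub>\<O>\<^esub> \<zeta>)"
  proof
    fix n
    obtain a b c where "a \<in> carrier G" "\<xi> n = a <# \<Gamma> n" "b \<in> carrier G" "\<eta> n = b <# \<Gamma> n"
      "c \<in> carrier G" "\<zeta> n = c <# \<Gamma> n"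
      using O odometer_coord_rep by metis
    then show "(\<xi> \<otimes>\<^bsub>\<O>\<^esub> \<eta> \<otimes>\<^bsub>\<O>\<^esub> \<zeta>) n = (\<xi> \<otimes>\<^bsub>\<O>\<^esub> (\<eta> \<otimes>\<^bsub>\<O>\<^esub> \<zeta>)) n"
      by (simp add: mult_odometer_group coset_mult m_assoc)
  qed
next
  fix \<xi> assume "\<xi> \<in> carrier \<O>"
  then have \<xi>: "\<xi> \<in> odometer_set G \<Gamma>" by simp
  then obtain g where g: "\<And>n. g n \<in> carrier G" "\<And>n m. m \<le> n \<Longrightarrow> \<xi> m = g n <# \<Gamma> m"
    unfolding odometer_set_iff by metis
  have \<Gamma>: "\<Gamma> n = \<one> <# \<Gamma> n" for n
    by (simp add: lcos_mult_one subgroup.subset[OF subgroup_\<Gamma>])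
  show "\<one>\<^bsub>\<O>\<^esub> \<otimes>\<^bsub>\<O>\<^esub> \<xi> = \<xi>"
  proof
    fix n show "(\<one>\<^bsub>\<O>\<^esub> \<otimes>\<^bsub>\<O>\<^esub> \<xi>) n = \<xi> n"
      using odometer_mult_coset[of \<one> "g n" \<Gamma> n \<xi>] \<Gamma>[of n] g(1) g(2)[of n n] by simp
  qed
  let ?\<eta> = "\<lambda>n. inv (g n) <# \<Gamma> n"
  \<comment> \<open>The coset of an inverse is well defined because \<open>\<Gamma> m\<close> is normal.\<close>
  have inv_eq: "inv (g n) <# \<Gamma> m = inv (g m) <# \<Gamma> m" if "m \<le> n" for m n
  proof -
    have "g m <# \<Gamma> m = g n <# \<Gamma> m" using g that by (metis order_refl)
    then have "inv (g m) \<otimes> g n \<in> \<Gamma> m" using g l_coset_eq_iff subgroup_\<Gamma> by blast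
    then have "g m \<otimes> (inv (g m) \<otimes> g n) \<otimes> inv (g m) \<in> \<Gamma> m"
      using normal.inv_op_closed2[OF normal] g by blast
    then have "g n \<otimes> inv (g m) \<in> \<Gamma> m" using g by (simp flip: m_assoc)
    then show ?thesis using l_coset_eq_iff[OF subgroup_\<Gamma>, of "inv (g n)" "inv (g m)" m] g by simp
  qed
  have "?\<eta> \<in> odometer_set G \<Gamma>"
    unfolding odometer_set_iff using inv_eq g by (metis inv_closed)
  moreover have "?\<eta> \<otimes>\<^bsub>\<O>\<^esub> \<xi> = \<one>\<^bsub>\<O>\<^esub>"
  proof
    fix n show "(?\<eta> \<otimes>\<^bsub>\<O>\<^esub> \<xi>) n = \<one>\<^bsub>\<O>\<^esub> n"
      using odometer_mult_coset[of "inv (g n)" "g n" ?\<eta> n \<xi>] g \<Gamma>[of n] by simp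
  qed
  ultimately show "\<exists>\<eta>\<in>carrier \<O>. \<eta> \<otimes>\<^bsub>\<O>\<^esub> \<xi> = \<one>\<^bsub>\<O>\<^esub>" by auto
qed (simp_all add: odometer_mult_in one_in_odometer)

sublocale O: group \<O> by (rule group_odometer_group)

lemma \<tau>_mult_eq_act:
  assumes "g \<in> carrier G" "\<xi> \<in> odometer_set G \<Gamma>"
  shows "\<tau> g \<otimes>\<^bsub>\<O>\<^esub> \<xi> = odometer_act G g \<xi>"
proof
  fix n
  obtain h where "h \<in> carrier G" "\<xi> n = h <# \<Gamma> n"
    using odometer_coord_rep[OF assms(2)] by blast
  then show "(\<tau> g \<otimes>\<^bsub>\<O>\<^esub> \<xi>) n = odometer_act G g \<xi> n"
    using assms(1) by (simp add: odometer_mult_coset[of g h] odometer_act_coset odometer_tau_def)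
qed

lemma homeomorphic_map_right_translation:
  assumes "\<xi> \<in> odometer_set G \<Gamma>"
  shows "homeomorphic_map (odometer G \<Gamma>) (odometer G \<Gamma>) (\<lambda>\<eta>. \<eta> \<otimes>\<^bsub>\<O>\<^esub> \<xi>)"
proof (rule homeomorphic_maps_imp_map[of _ _ _ "\<lambda>\<eta>. \<eta> \<otimes>\<^bsub>\<O>\<^esub> inv\<^bsub>\<O>\<^esub> \<xi>"])
  have c: "continuous_map (odometer G \<Gamma>) (odometer G \<Gamma>) (\<lambda>\<eta>. \<eta> \<otimes>\<^bsub>\<O>\<^esub> \<zeta>)" if "\<zeta> \<in> carrier \<O>" for \<zeta>
    using that by (intro continuous_map_odometer odometer_mult_in) (simp_all add: mult_odometer_group)
  show "homeomorphic_maps (odometer G \<Gamma>) (odometer G \<Gamma>) (\<lambda>\<eta>. \<eta> \<otimes>\<^bsub>\<O>\<^esub> \<xi>) (\<lambda>\<eta>. \<eta> \<otimes>\<^bsub>\<O>\<^esub> inv\<^bsub>\<O>\<^esub> \<xi>)"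
    unfolding homeomorphic_maps_def topspace_odometer
  proof (intro conjI ballI c)
    fix \<eta> assume "\<eta> \<in> odometer_set G \<Gamma>"
    then show "\<eta> \<otimes>\<^bsub>\<O>\<^esub> \<xi> \<otimes>\<^bsub>\<O>\<^esub> inv\<^bsub>\<O>\<^esub> \<xi> = \<eta>" "\<eta> \<otimes>\<^bsub>\<O>\<^esub> inv\<^bsub>\<O>\<^esub> \<xi> \<otimes>\<^bsub>\<O>\<^esub> \<xi> = \<eta>"
      using assms O.m_assoc O.inv_closed O.r_inv O.l_inv O.r_one by simp_all
  qed (use assms O.inv_closed[of \<xi>] in simp_all)
qed

lemma r_coset_odometer: "W #>\<^bsub>\<O>\<^esub> \<xi> = (\<lambda>\<eta>. \<eta> \<otimes>\<^bsub>\<O>\<^esub> \<xi>) ` W"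
  by (auto simp: r_coset_def)

end

section \<open>Model sets of generic windows\<close>

lemma closure_of_meets_nbhd:
  assumes "p \<in> T closure_of S" "openin T U" "p \<in> U"
  obtains s where "s \<in> S" "s \<in> U"
  using assms by (auto simp: in_closure_of)

text \<open>Since \<open>\<tau> g\<close> does not lie on the boundary, it has a neighbourhood inside \<open>W\<close> or one outside
  \<open>W\<close>.\<close>

lemma (in normal_odometer) window_locally_decided:
  assumes closed: "closedin (odometer G \<Gamma>) W" and generic: "generic_window G \<Gamma> W" and g: "g \<in> carrier G"
  shows "\<exists>n. \<forall>\<zeta>\<in>odometer_set G \<Gamma>. \<zeta> n = \<tau> g n \<longrightarrow> (\<zeta> \<in> W \<longleftrightarrow> \<tau> g \<in> W)"
proof (cases "\<tau> g \<in> W")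
  case True
  have "\<tau> g \<notin> odometer G \<Gamma> frontier_of W"
    using generic g by (auto simp: generic_window_def)
  then have "\<tau> g \<in> odometer G \<Gamma> interior_of W"
    using True closed by (simp add: frontier_of_def closure_of_closedin)
  from openin_odometer_nbhd[OF openin_interior_of this]
  obtain n where "\<forall>\<eta>\<in>odometer_set G \<Gamma>. \<eta> n = \<tau> g n \<longrightarrow> \<eta> \<in> odometer G \<Gamma> interior_of W"
    by metis
  then have "\<forall>\<zeta>\<in>odometer_set G \<Gamma>. \<zeta> n = \<tau> g n \<longrightarrow> (\<zeta> \<in> W \<longleftrightarrow> \<tau> g \<in> W)"
    using True interior_of_subset[of "odometer G \<Gamma>" W] by auto
  then show ?thesis ..
next
  case False
  have "openin (odometer G \<Gamma>) (odometer_set G \<Gamma> - W)"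
    using closed by (simp add: closedin_def topspace_odometer)
  moreover have "\<tau> g \<in> odometer_set G \<Gamma> - W" using False \<tau>_in[OF g] by simp
  ultimately obtain n where "\<forall>\<eta>\<in>odometer_set G \<Gamma>. \<eta> n = \<tau> g n \<longrightarrow> \<eta> \<in> odometer_set G \<Gamma> - W"
    by (rule openin_odometer_nbhd)
  then have "\<forall>\<zeta>\<in>odometer_set G \<Gamma>. \<zeta> n = \<tau> g n \<longrightarrow> (\<zeta> \<in> W \<longleftrightarrow> \<tau> g \<in> W)"
    using False by auto
  then show ?thesis ..
qed

lemma (in normal_odometer) window_locally_decided_finite:
  assumes W: "closedin (odometer G \<Gamma>) W" "generic_window G \<Gamma> W" and F: "finite F" "F \<subseteq> carrier G"
  shows "\<exists>n. \<forall>h\<in>F. \<forall>\<zeta>\<in>odometer_set G \<Gamma>. \<zeta> n = \<tau> h n \<longrightarrow> (\<zeta> \<in> W \<longleftrightarrow> \<tau> h \<in> W)"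
proof -
  obtain N where N: "\<And>h \<zeta>. \<lbrakk>h \<in> carrier G; \<zeta> \<in> odometer_set G \<Gamma>; \<zeta> (N h) = \<tau> h (N h)\<rbrakk>
      \<Longrightarrow> \<zeta> \<in> W \<longleftrightarrow> \<tau> h \<in> W"
    using window_locally_decided[OF W] by metis
  obtain n where n: "\<And>h. h \<in> F \<Longrightarrow> N h \<le> n"
    using F(1) finite_imageI[of F N] unfolding finite_nat_set_iff_bounded_le by blast
  have "\<zeta> \<in> W \<longleftrightarrow> \<tau> h \<in> W"
    if "h \<in> F" "\<zeta> \<in> odometer_set G \<Gamma>" "\<zeta> n = \<tau> h n" for h \<zeta>
  proof -
    have h: "h \<in> carrier G" using that F(2) by blast
    then have "\<zeta> (N h) = \<tau> h (N h)"
      using odometer_coord_antimono[OF that(2) \<tau>_in that(3) n] that(1) by blast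
    then show ?thesis using N h that(2) by blast
  qed
  then show ?thesis by blast
qed

locale odometer_window = normal_odometer G \<Gamma> for G (structure) and \<Gamma> :: "nat \<Rightarrow> 'a set" +
  fixes W :: "(nat \<Rightarrow> 'a set) set"
  assumes countable_G: "countable (carrier G)"
    and proper: "proper_window G \<Gamma> W"
    and irredundant: "irredundant_window G \<Gamma> W"
    and generic: "generic_window G \<Gamma> W"
begin

abbreviation x where "x \<equiv> model_set G \<Gamma> W"
abbreviation X where "X \<equiv> orbit_closure G x"

lemma model_set_apply: "g \<in> carrier G \<Longrightarrow> x g = (if \<tau> g \<in> W then 1 else 0)"
  by (simp add: model_set_def)

lemma model_set_in_full_shift: "x \<in> topspace (full_shift G)"
  by (auto simp: topspace_full_shift model_set_def)

lemma closedin_window: "closedin (odometer G \<Gamma>) W"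
  using proper compactin_imp_closedin Hausdorff_space_odometer
  by (auto simp: proper_window_def)

lemma Toeplitz_model_set: "Toeplitz G x"
  unfolding Toeplitz_def
proof (intro conjI ballI model_set_in_full_shift)
  fix g assume g: "g \<in> carrier G"
  obtain n where n: "\<forall>\<zeta>\<in>odometer_set G \<Gamma>. \<zeta> n = \<tau> g n \<longrightarrow> (\<zeta> \<in> W \<longleftrightarrow> \<tau> g \<in> W)"
    using window_locally_decided[OF closedin_window generic] g by blast
  have "x (g \<otimes> \<gamma>) = x g" if \<gamma>: "\<gamma> \<in> \<Gamma> n" for \<gamma>
  proof -
    have \<gamma>G: "\<gamma> \<in> carrier G" using \<gamma> subgroup.subset[OF subgroup_\<Gamma>] by blast
    then have "\<tau> (g \<otimes> \<gamma>) n = \<tau> g n"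
      using \<gamma> g coset_act[of g \<gamma> n] coset_eq_\<Gamma>_iff[of \<gamma> n] by (simp add: odometer_tau_def)
    then have "\<tau> (g \<otimes> \<gamma>) \<in> W \<longleftrightarrow> \<tau> g \<in> W"
      using n \<tau>_in[of "g \<otimes> \<gamma>"] g \<gamma>G by simp
    then show ?thesis using g \<gamma>G by (simp add: model_set_apply)
  qed
  moreover have "finite_index_subgroup G (\<Gamma> n)"
    using sequence by (simp add: odometer_sequence_def)
  ultimately show "\<exists>H. finite_index_subgroup G H \<and> (\<forall>\<gamma>\<in>H. x (g \<otimes> \<gamma>) = x g)" by blast
qed

text \<open>The pairs \<open>(y, \<xi>)\<close> such that \<open>g x\<close> and \<open>\<tau> g\<close> approximate \<open>y\<close> and \<open>\<xi>\<close> for the same \<open>g\<close>. The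
  factor map from \<open>X\<close> to the odometer has to send \<open>g x\<close> to \<open>\<tau> g\<close> if it sends \<open>x\<close> to the identity, and
  it is obtained by showing that this closed relation is a function.\<close>

definition graph_closure :: "(('a \<Rightarrow> nat) \<times> (nat \<Rightarrow> 'a set)) set" where
  "graph_closure = prod_topology X (odometer G \<Gamma>) closure_of ((\<lambda>g. (shift_act G g x, \<tau> g)) ` carrier G)"

lemma orbit_in_graph_closure:
  assumes "g \<in> carrier G" shows "(shift_act G g x, \<tau> g) \<in> graph_closure"
proof -
  have "(\<lambda>g. (shift_act G g x, \<tau> g)) ` carrier G \<subseteq> topspace (prod_topology X (odometer G \<Gamma>))"
    using orbit_in_orbit_closure[OF model_set_in_full_shift] \<tau>_in by (auto simp: topspace_odometer)
  from closure_of_subset[OF this] show ?thesis using assms by (auto simp: graph_closure_def)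
qed

lemma graph_closure_subset: "graph_closure \<subseteq> topspace X \<times> odometer_set G \<Gamma>"
  using closure_of_subset_topspace[of "prod_topology X (odometer G \<Gamma>)"]
  by (simp add: graph_closure_def topspace_odometer)

lemma graph_closure_approx:
  assumes pair: "(y, \<xi>) \<in> graph_closure" and F: "finite F" "F \<subseteq> carrier G"
  obtains g where "g \<in> carrier G" "\<And>h. h \<in> F \<Longrightarrow> y h = x (h \<otimes> g)" "\<xi> n = g <# \<Gamma> n"
proof -
  have y: "y \<in> topspace X" and \<xi>: "\<xi> \<in> odometer_set G \<Gamma>" using pair graph_closure_subset by auto
  let ?A = "cylinder G F y \<inter> topspace X" and ?B = "{\<eta> \<in> odometer_set G \<Gamma>. \<eta> n = \<xi> n}"
  have "openin X ?A"
    using openin_cylinder[OF F] unfolding topspace_orbit_closure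
    unfolding orbit_closure_def by (rule openin_subtopology_Int)
  moreover have "openin (odometer G \<Gamma>) ?B"
    unfolding openin_odometer_iff by auto
  ultimately have "openin (prod_topology X (odometer G \<Gamma>)) (?A \<times> ?B)"
    by (simp add: openin_prod_Times_iff)
  moreover have "(y, \<xi>) \<in> ?A \<times> ?B"
    using y \<xi> orbit_closure_subset by (auto simp: cylinder_def)
  ultimately obtain s where "s \<in> (\<lambda>g. (shift_act G g x, \<tau> g)) ` carrier G" "s \<in> ?A \<times> ?B"
    by (rule closure_of_meets_nbhd[OF pair[unfolded graph_closure_def]])
  then obtain g where g: "g \<in> carrier G" "shift_act G g x \<in> ?A" "\<tau> g \<in> ?B"
    by auto
  show ?thesis
  proof (rule that[of g])
    show "y h = x (h \<otimes> g)" if "h \<in> F" for h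
    proof -
      have "shift_act G g x h = y h" using g(2) that by (simp add: cylinder_def)
      then show ?thesis using that F(2) by (simp add: shift_act_def subset_iff)
    qed
    show "\<xi> n = g <# \<Gamma> n"
      using g(3) by (simp add: odometer_tau_def)
  qed (rule g)
qed

text \<open>Together with the next lemma, this confines \<open>y\<close> between two model sets: the one of the interior
  of \<open>W \<xi>\<^sup>-\<^sup>1\<close> and the one of \<open>W \<xi>\<^sup>-\<^sup>1\<close> itself. Both hold because, for \<open>\<tau> g\<close> close to \<open>\<xi>\<close>, the point
  \<open>\<tau> (h \<otimes> g)\<close> is close to \<open>\<tau> h \<xi>\<close>.\<close>

lemma graph_closure_interior:
  assumes pair: "(y, \<xi>) \<in> graph_closure" and h: "h \<in> carrier G"
    and int: "\<tau> h \<otimes>\<^bsub>\<O>\<^esub> \<xi> \<in> odometer G \<Gamma> interior_of W"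
  shows "y h = 1"
proof -
  have \<xi>: "\<xi> \<in> odometer_set G \<Gamma>" using pair graph_closure_subset by auto
  obtain n where n: "\<forall>\<zeta>\<in>odometer_set G \<Gamma>. \<zeta> n = (\<tau> h \<otimes>\<^bsub>\<O>\<^esub> \<xi>) n \<longrightarrow> \<zeta> \<in> odometer G \<Gamma> interior_of W"
    using openin_odometer_nbhd[OF openin_interior_of int] by metis
  obtain g where g: "g \<in> carrier G" "y h = x (h \<otimes> g)" "\<xi> n = g <# \<Gamma> n"
    using graph_closure_approx[OF pair, of "{h}"] h by auto
  have "\<tau> (h \<otimes> g) n = (\<tau> h \<otimes>\<^bsub>\<O>\<^esub> \<xi>) n"
    using g h \<xi> by (simp add: \<tau>_mult_eq_act odometer_act_coset) (simp add: odometer_tau_def)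
  then have "\<tau> (h \<otimes> g) \<in> odometer G \<Gamma> interior_of W"
    using n \<tau>_in[of "h \<otimes> g"] h g(1) by simp
  then have "\<tau> (h \<otimes> g) \<in> W"
    using interior_of_subset[of "odometer G \<Gamma>" W] by (rule subsetD[rotated])
  then show ?thesis using g h by (simp add: model_set_apply)
qed

lemma graph_closure_exterior:
  assumes pair: "(y, \<xi>) \<in> graph_closure" and h: "h \<in> carrier G" and ext: "\<tau> h \<otimes>\<^bsub>\<O>\<^esub> \<xi> \<notin> W"
  shows "y h = 0"
proof -
  have \<xi>: "\<xi> \<in> odometer_set G \<Gamma>" using pair graph_closure_subset by auto
  have "openin (odometer G \<Gamma>) (odometer_set G \<Gamma> - W)"
    using closedin_window by (simp add: closedin_def topspace_odometer)
  moreover have "\<tau> h \<otimes>\<^bsub>\<O>\<^esub> \<xi> \<in> odometer_set G \<Gamma> - W"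
    using ext odometer_mult_in[OF \<tau>_in \<xi>] h by blast
  ultimately obtain n where n: "\<forall>\<zeta>\<in>odometer_set G \<Gamma>. \<zeta> n = (\<tau> h \<otimes>\<^bsub>\<O>\<^esub> \<xi>) n \<longrightarrow> \<zeta> \<in> odometer_set G \<Gamma> - W"
    by (rule openin_odometer_nbhd)
  obtain g where g: "g \<in> carrier G" "y h = x (h \<otimes> g)" "\<xi> n = g <# \<Gamma> n"
    using graph_closure_approx[OF pair, of "{h}"] h by auto
  have "\<tau> (h \<otimes> g) n = (\<tau> h \<otimes>\<^bsub>\<O>\<^esub> \<xi>) n"
    using g h \<xi> by (simp add: \<tau>_mult_eq_act odometer_act_coset) (simp add: odometer_tau_def)
  then have "\<tau> (h \<otimes> g) \<notin> W"
    using n \<tau>_in[of "h \<otimes> g"] h g(1) by simp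
  then show ?thesis using g h by (simp add: model_set_apply)
qed

text \<open>If this failed, the points near \<open>\<zeta>\<close> would contain some \<open>\<tau> h\<close> with \<open>\<tau> h \<xi>\<close> interior to \<open>W\<close> and
  \<open>\<tau> h \<eta>\<close> outside \<open>W\<close>, because \<open>W\<close> is the closure of its interior and \<open>\<tau>\<close> has dense image. Then
  \<open>y h\<close> would be both \<open>1\<close> and \<open>0\<close>.\<close>

lemma graph_closure_window_translate:
  assumes \<xi>: "(y, \<xi>) \<in> graph_closure" and \<eta>: "(y, \<eta>) \<in> graph_closure" and \<zeta>: "\<zeta> \<in> odometer_set G \<Gamma>"
    and W: "\<zeta> \<otimes>\<^bsub>\<O>\<^esub> \<xi> \<in> W"
  shows "\<zeta> \<otimes>\<^bsub>\<O>\<^esub> \<eta> \<in> W"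
proof (rule ccontr)
  assume n: "\<zeta> \<otimes>\<^bsub>\<O>\<^esub> \<eta> \<notin> W"
  have O: "\<xi> \<in> odometer_set G \<Gamma>" "\<eta> \<in> odometer_set G \<Gamma>" using \<xi> \<eta> graph_closure_subset by auto
  let ?N = "{\<omega> \<in> topspace (odometer G \<Gamma>). \<omega> \<otimes>\<^bsub>\<O>\<^esub> \<eta> \<in> odometer_set G \<Gamma> - W}"
  let ?I = "odometer G \<Gamma> interior_of W"
  have opN: "openin (odometer G \<Gamma>) ?N"
    using closedin_window homeomorphic_imp_continuous_map[OF homeomorphic_map_right_translation[OF O(2)]]
    by (intro openin_continuous_map_preimage[where Y = "odometer G \<Gamma>"])
       (auto simp: closedin_def topspace_odometer)
  have opN': "openin (odometer G \<Gamma>) ((\<lambda>\<omega>. \<omega> \<otimes>\<^bsub>\<O>\<^esub> \<xi>) ` ?N)"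
    using homeomorphic_map_openness_eq[OF homeomorphic_map_right_translation[OF O(1)]] opN by blast
  have "\<zeta> \<in> ?N" using \<zeta> n O odometer_mult_in by (simp add: topspace_odometer)
  then have \<zeta>N: "\<zeta> \<otimes>\<^bsub>\<O>\<^esub> \<xi> \<in> (\<lambda>\<omega>. \<omega> \<otimes>\<^bsub>\<O>\<^esub> \<xi>) ` ?N" by blast
  have "\<zeta> \<otimes>\<^bsub>\<O>\<^esub> \<xi> \<in> odometer G \<Gamma> closure_of ?I"
    using W proper by (simp add: proper_window_def)
  then obtain s where "s \<in> ?I" "s \<in> (\<lambda>\<omega>. \<omega> \<otimes>\<^bsub>\<O>\<^esub> \<xi>) ` ?N"
    by (rule closure_of_meets_nbhd[OF _ opN' \<zeta>N])
  then obtain \<omega> where \<omega>: "\<omega> \<in> ?N" "\<omega> \<otimes>\<^bsub>\<O>\<^esub> \<xi> \<in> ?I" by auto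
  have "openin (odometer G \<Gamma>) {\<omega> \<in> topspace (odometer G \<Gamma>). \<omega> \<otimes>\<^bsub>\<O>\<^esub> \<xi> \<in> ?I}"
    using homeomorphic_imp_continuous_map[OF homeomorphic_map_right_translation[OF O(1)]]
    by (intro openin_continuous_map_preimage[where Y = "odometer G \<Gamma>"]) auto
  from openin_Int[OF opN this]
  obtain h where h: "h \<in> carrier G" "\<tau> h \<in> ?N" "\<tau> h \<otimes>\<^bsub>\<O>\<^esub> \<xi> \<in> ?I"
    using \<tau>_dense \<omega> by blast
  have "y h = 1" by (rule graph_closure_interior[OF \<xi> h(1,3)])
  moreover have "y h = 0" using h(2) by (intro graph_closure_exterior[OF \<eta> h(1)]) blast
  ultimately show False by simp
qed

text \<open>By the previous lemma in both directions, \<open>W \<xi>\<^sup>-\<^sup>1 = W \<eta>\<^sup>-\<^sup>1\<close>, so \<open>\<xi>\<^sup>-\<^sup>1 \<eta>\<close> is a period of \<open>W\<close> and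
  irredundance applies.\<close>

lemma graph_closure_unique:
  assumes \<xi>: "(y, \<xi>) \<in> graph_closure" and \<eta>: "(y, \<eta>) \<in> graph_closure"
  shows "\<xi> = \<eta>"
proof -
  have O: "\<xi> \<in> carrier \<O>" "\<eta> \<in> carrier \<O>" using \<xi> \<eta> graph_closure_subset by auto
  have WO: "W \<subseteq> carrier \<O>"
    using closedin_subset[OF closedin_window] by (simp add: topspace_odometer)
  have step: "\<omega> \<otimes>\<^bsub>\<O>\<^esub> (inv\<^bsub>\<O>\<^esub> \<alpha> \<otimes>\<^bsub>\<O>\<^esub> \<beta>) \<in> W"
    if "(y, \<alpha>) \<in> graph_closure" "(y, \<beta>) \<in> graph_closure" "\<alpha> \<in> carrier \<O>" "\<beta> \<in> carrier \<O>" "\<omega> \<in> W" for \<alpha> \<beta> \<omega>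
  proof -
    have \<omega>: "\<omega> \<in> carrier \<O>" using that WO by blast
    have "(\<omega> \<otimes>\<^bsub>\<O>\<^esub> inv\<^bsub>\<O>\<^esub> \<alpha>) \<otimes>\<^bsub>\<O>\<^esub> \<alpha> = \<omega>"
      using that \<omega> O.m_assoc O.l_inv O.r_one O.inv_closed by metis
    then have "(\<omega> \<otimes>\<^bsub>\<O>\<^esub> inv\<^bsub>\<O>\<^esub> \<alpha>) \<otimes>\<^bsub>\<O>\<^esub> \<beta> \<in> W"
      using graph_closure_window_translate[OF that(1,2)] that \<omega> O.m_closed O.inv_closed
      by (metis carrier_odometer_group)
    then show ?thesis using that \<omega> O.m_assoc O.inv_closed by metis
  qed
  let ?\<delta> = "inv\<^bsub>\<O>\<^esub> \<xi> \<otimes>\<^bsub>\<O>\<^esub> \<eta>"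
  have \<delta>: "?\<delta> \<in> carrier \<O>" using O O.m_closed O.inv_closed by blast
  have "W #>\<^bsub>\<O>\<^esub> ?\<delta> = W"
  proof
    show "W #>\<^bsub>\<O>\<^esub> ?\<delta> \<subseteq> W"
      using step[OF \<xi> \<eta> O] by (auto simp: r_coset_odometer)
    show "W \<subseteq> W #>\<^bsub>\<O>\<^esub> ?\<delta>"
    proof
      fix \<omega> assume \<omega>: "\<omega> \<in> W"
      let ?\<omega>' = "\<omega> \<otimes>\<^bsub>\<O>\<^esub> (inv\<^bsub>\<O>\<^esub> \<eta> \<otimes>\<^bsub>\<O>\<^esub> \<xi>)"
      have "?\<omega>' \<in> W" using step[OF \<eta> \<xi>] O \<omega> by blast
      moreover have "inv\<^bsub>\<O>\<^esub> \<eta> \<otimes>\<^bsub>\<O>\<^esub> \<xi> = inv\<^bsub>\<O>\<^esub> ?\<delta>"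
        using O O.inv_mult_group O.inv_inv O.inv_closed by metis
      then have "?\<omega>' \<otimes>\<^bsub>\<O>\<^esub> ?\<delta> = \<omega> \<otimes>\<^bsub>\<O>\<^esub> (inv\<^bsub>\<O>\<^esub> ?\<delta> \<otimes>\<^bsub>\<O>\<^esub> ?\<delta>)"
        using O.m_assoc[OF subsetD[OF WO \<omega>] O.inv_closed[OF \<delta>] \<delta>] by simp
      then have "?\<omega>' \<otimes>\<^bsub>\<O>\<^esub> ?\<delta> = \<omega>"
        using O.l_inv[OF \<delta>] O.r_one[OF subsetD[OF WO \<omega>]] by simp
      ultimately show "\<omega> \<in> W #>\<^bsub>\<O>\<^esub> ?\<delta>" unfolding r_coset_odometer by force
    qed
  qed
  then have "?\<delta> = \<one>\<^bsub>\<O>\<^esub>"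
    using irredundant \<delta> unfolding irredundant_window_def by blast
  then show ?thesis using O by (metis O.inv_closed O.inv_equality O.inv_inv)
qed

lemma graph_closure_act:
  assumes pair: "(y, \<xi>) \<in> graph_closure" and k: "k \<in> carrier G"
  shows "(shift_act G k y, odometer_act G k \<xi>) \<in> graph_closure"
proof -
  let ?P = "prod_topology X (odometer G \<Gamma>)" and ?f = "\<lambda>p. (shift_act G k (fst p), odometer_act G k (snd p))"
  let ?S = "(\<lambda>g. (shift_act G g x, \<tau> g)) ` carrier G"
  have "continuous_map X X (shift_act G k)"
    using dynamical_system_orbit_closure[OF model_set_in_full_shift countable_G] k
    by (simp add: dynamical_system_def)
  moreover have "continuous_map (odometer G \<Gamma>) (odometer G \<Gamma>) (odometer_act G k)"
    using dynamical_system_odometer k by (simp add: dynamical_system_def)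
  ultimately have "continuous_map ?P ?P ?f"
    by (intro continuous_map_pairedI continuous_map_compose[OF continuous_map_fst, unfolded comp_def]
        continuous_map_compose[OF continuous_map_snd, unfolded comp_def])
  then have "?f ` (?P closure_of ?S) \<subseteq> ?P closure_of ?f ` ?S"
    by (rule continuous_map_image_closure_subset)
  moreover have "?f ` ?S \<subseteq> ?S"
  proof
    fix p assume "p \<in> ?f ` ?S"
    then obtain g where "g \<in> carrier G" "p = (shift_act G k (shift_act G g x), odometer_act G k (\<tau> g))"
      by auto
    then show "p \<in> ?S"
      using k by (intro image_eqI[of _ _ "k \<otimes> g"]) (simp_all add: shift_act_mult \<tau>_mult)
  qed
  then have "?P closure_of ?f ` ?S \<subseteq> ?P closure_of ?S" by (rule closure_of_mono)
  ultimately show ?thesis using pair unfolding graph_closure_def by force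
qed

text \<open>A quantitative form of the fact that the fibre over the identity is \<open>{x}\<close>. If \<open>\<xi>\<close> agrees with the
  identity at level \<open>n\<close>, then \<open>y\<close> is approximated by \<open>g x\<close> with \<open>g\<close> in \<open>\<Gamma> n\<close>, and such a shift leaves the
  values of \<open>x\<close> on \<open>F\<close> unchanged when \<open>n\<close> is large.\<close>

lemma graph_closure_fibre_one:
  assumes F: "finite F" "F \<subseteq> carrier G"
  shows "\<exists>n. \<forall>y \<xi>. (y, \<xi>) \<in> graph_closure \<and> \<xi> n = \<Gamma> n \<longrightarrow> y \<in> cylinder G F x"
proof -
  obtain n where n: "\<forall>h\<in>F. \<forall>\<zeta>\<in>odometer_set G \<Gamma>. \<zeta> n = \<tau> h n \<longrightarrow> (\<zeta> \<in> W \<longleftrightarrow> \<tau> h \<in> W)"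
    using window_locally_decided_finite[OF closedin_window generic F] by blast
  have "y \<in> cylinder G F x" if pair: "(y, \<xi>) \<in> graph_closure" and \<xi>: "\<xi> n = \<Gamma> n" for y \<xi>
  proof -
    obtain g where g: "g \<in> carrier G" "\<And>h. h \<in> F \<Longrightarrow> y h = x (h \<otimes> g)" "\<xi> n = g <# \<Gamma> n"
      using graph_closure_approx[OF pair F] by blast
    have "y h = x h" if h: "h \<in> F" for h
    proof -
      have hG: "h \<in> carrier G" using h F by blast
      then have "\<tau> (h \<otimes> g) n = \<tau> h n"
        using g \<xi> coset_act[of h g n] by (simp add: odometer_tau_def)
      then have "\<tau> (h \<otimes> g) \<in> W \<longleftrightarrow> \<tau> h \<in> W"
        using n h \<tau>_in[of "h \<otimes> g"] hG g(1) by simp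
      then show ?thesis using g h hG by (simp add: model_set_apply)
    qed
    moreover have "y \<in> topspace (full_shift G)"
      using pair graph_closure_subset orbit_closure_subset by blast
    ultimately show ?thesis by (simp add: cylinder_def)
  qed
  then show ?thesis by blast
qed

lemma compact_space_X: "compact_space X"
  using dynamical_system_orbit_closure[OF model_set_in_full_shift countable_G]
  by (simp add: dynamical_system_def)

lemma compactin_graph_closure: "compactin (prod_topology X (odometer G \<Gamma>)) graph_closure"
  unfolding graph_closure_def
  by (intro closedin_compact_space closedin_closure_of)
     (simp add: compact_space_prod_topology compact_space_X compact_space_odometer)

lemma fst_graph_closure: "fst ` graph_closure = topspace X"
proof
  show "fst ` graph_closure \<subseteq> topspace X" using graph_closure_subset by auto
  have "compactin X (fst ` graph_closure)"
    using image_compactin[OF compactin_graph_closure continuous_map_fst] .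
  then have "closedin X (fst ` graph_closure)"
    using compactin_imp_closedin Hausdorff_space_orbit_closure by blast
  then have "closedin (full_shift G) (fst ` graph_closure)"
    unfolding orbit_closure_def using closedin_trans_full closedin_closure_of by blast
  moreover have "(\<lambda>g. shift_act G g x) ` carrier G \<subseteq> fst ` graph_closure"
    using orbit_in_graph_closure by force
  ultimately show "topspace X \<subseteq> fst ` graph_closure"
    unfolding topspace_orbit_closure by (intro closure_of_minimal)
qed

lemma snd_graph_closure: "snd ` graph_closure = odometer_set G \<Gamma>"
proof
  show "snd ` graph_closure \<subseteq> odometer_set G \<Gamma>" using graph_closure_subset by auto
  have "compactin (odometer G \<Gamma>) (snd ` graph_closure)"
    using image_compactin[OF compactin_graph_closure continuous_map_snd] .
  then have "closedin (odometer G \<Gamma>) (snd ` graph_closure)"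
    using compactin_imp_closedin Hausdorff_space_odometer by blast
  then have "openin (odometer G \<Gamma>) (odometer_set G \<Gamma> - snd ` graph_closure)"
    by (simp add: closedin_def topspace_odometer)
  then show "odometer_set G \<Gamma> \<subseteq> snd ` graph_closure"
    using \<tau>_dense[of "odometer_set G \<Gamma> - snd ` graph_closure"] orbit_in_graph_closure by (metis DiffE Diff_eq_empty_iff image_eqI snd_conv)
qed

text \<open>The first projection of the compact relation is a continuous bijection onto \<open>X\<close>, hence a
  homeomorphism; composing its inverse with the second projection gives the factor map.\<close>

lemma ex_factor_to_odometer:
  obtains \<pi> where "factor_map G X (shift_act G) (odometer G \<Gamma>) (odometer_act G) \<pi>"
    and "\<And>y. y \<in> topspace X \<Longrightarrow> (y, \<pi> y) \<in> graph_closure"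
proof -
  let ?P = "prod_topology X (odometer G \<Gamma>)"
  have topZ: "topspace (subtopology ?P graph_closure) = graph_closure"
    using graph_closure_subset by (auto simp: topspace_odometer)
  have "homeomorphic_map (subtopology ?P graph_closure) X fst"
  proof (rule continuous_imp_homeomorphic_map)
    show "continuous_map (subtopology ?P graph_closure) X fst"
      by (intro continuous_map_from_subtopology continuous_map_fst)
    show "compact_space (subtopology ?P graph_closure)"
      by (intro compact_space_subtopology compactin_graph_closure)
    show "fst ` topspace (subtopology ?P graph_closure) = topspace X"
      by (simp only: topZ fst_graph_closure)
    show "inj_on fst (topspace (subtopology ?P graph_closure))"
      unfolding topZ using graph_closure_unique by (force simp: inj_on_def)
  qed (rule Hausdorff_space_orbit_closure)
  then obtain s where s: "homeomorphic_maps (subtopology ?P graph_closure) X fst s"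
    unfolding homeomorphic_map_maps by blast
  have cs: "continuous_map X (subtopology ?P graph_closure) s" and fs: "\<And>y. y \<in> topspace X \<Longrightarrow> fst (s y) = y"
    using s by (auto simp: homeomorphic_maps_def)
  have sZ: "s y \<in> graph_closure" if "y \<in> topspace X" for y
    using cs that topZ by (auto simp: continuous_map_def)
  define \<pi> where "\<pi> = (\<lambda>y. snd (s y))"
  have \<pi>_graph: "(y, \<pi> y) \<in> graph_closure" if "y \<in> topspace X" for y
    using sZ[OF that] fs[OF that] by (metis \<pi>_def prod.collapse)
  have \<pi>_eq: "\<pi> y = \<xi>" if "(y, \<xi>) \<in> graph_closure" for y \<xi>
    using that \<pi>_graph graph_closure_unique graph_closure_subset by blast
  have "factor_map G X (shift_act G) (odometer G \<Gamma>) (odometer_act G) \<pi>"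
    unfolding factor_map_def
  proof (intro conjI ballI)
    show "dynamical_system G X (shift_act G)"
      by (rule dynamical_system_orbit_closure[OF model_set_in_full_shift countable_G])
    show "dynamical_system G (odometer G \<Gamma>) (odometer_act G)"
      by (rule dynamical_system_odometer)
    show "continuous_map X (odometer G \<Gamma>) \<pi>"
      unfolding \<pi>_def
      by (rule continuous_map_compose[OF cs, of _ snd, unfolded comp_def])
         (intro continuous_map_from_subtopology continuous_map_snd)
    show "\<pi> ` topspace X = topspace (odometer G \<Gamma>)"
      unfolding topspace_odometer
    proof
      show "\<pi> ` topspace X \<subseteq> odometer_set G \<Gamma>" using \<pi>_graph graph_closure_subset by blast
      show "odometer_set G \<Gamma> \<subseteq> \<pi> ` topspace X"
      proof
        fix \<xi> assume "\<xi> \<in> odometer_set G \<Gamma>"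
        then obtain y where y: "(y, \<xi>) \<in> graph_closure" unfolding snd_graph_closure[symmetric] by auto
        then show "\<xi> \<in> \<pi> ` topspace X" using \<pi>_eq[OF y] graph_closure_subset by blast
      qed
    qed
    show "\<pi> (shift_act G g y) = odometer_act G g (\<pi> y)" if "g \<in> carrier G" "y \<in> topspace X" for g y
      using \<pi>_eq[OF graph_closure_act[OF \<pi>_graph[OF that(2)] that(1)]] .
  qed
  then show ?thesis using that \<pi>_graph by blast
qed

text \<open>An equicontinuous factor of \<open>X\<close> is constant on the fibres of \<open>\<pi>\<close>, by proximality: if \<open>\<pi> y = \<pi> z\<close> and
  \<open>g\<close> represents this point at a high level, then \<open>inv g\<close> moves both \<open>y\<close> and \<open>z\<close> close to \<open>x\<close>, so
  their images become close, and applying \<open>g\<close> again keeps them close.\<close>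

lemma is_MEF_model_set: "is_MEF G X (shift_act G) (odometer G \<Gamma>) (odometer_act G)"
  unfolding is_MEF_def
proof (intro conjI equicontinuous_system_odometer)
  obtain \<pi> where \<pi>: "factor_map G X (shift_act G) (odometer G \<Gamma>) (odometer_act G) \<pi>"
    and \<pi>_graph: "\<And>y. y \<in> topspace X \<Longrightarrow> (y, \<pi> y) \<in> graph_closure"
    using ex_factor_to_odometer by blast
  have \<pi>O: "\<pi> y \<in> odometer_set G \<Gamma>" if "y \<in> topspace X" for y
    using \<pi>_graph[OF that] graph_closure_subset by blast
  have \<pi>_act: "\<pi> (shift_act G g y) = odometer_act G g (\<pi> y)" if "g \<in> carrier G" "y \<in> topspace X" for g y
    using \<pi> that by (simp add: factor_map_def)
  have actX: "shift_act G g y \<in> topspace X" if "g \<in> carrier G" "y \<in> topspace X" for g y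
    using shift_act_orbit_closure[OF model_set_in_full_shift] that by blast
  have "\<exists>\<psi>. factor_map G (odometer G \<Gamma>) (odometer_act G) Y b \<psi> \<and> (\<forall>y\<in>topspace X. \<phi> y = \<psi> (\<pi> y))"
    if Y: "equicontinuous_system G Y b" and \<phi>: "factor_map G X (shift_act G) Y b \<phi>"
    for Y :: "('a \<Rightarrow> nat) topology" and b \<phi>
  proof -
    obtain d where d: "Metric_space (topspace Y) d" "Metric_space.mtopology (topspace Y) d = Y"
      and equi: "\<And>\<epsilon>. \<epsilon> > 0 \<Longrightarrow> \<exists>\<delta>>0. \<forall>u\<in>topspace Y. \<forall>v\<in>topspace Y.
           d u v < \<delta> \<longrightarrow> (\<forall>g\<in>carrier G. d (b g u) (b g v) < \<epsilon>)"
      using Y unfolding equicontinuous_system_def by blast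
    interpret M: Metric_space "topspace Y" d by (rule d)
    have c\<phi>: "continuous_map X Y \<phi>" and \<phi>X: "\<phi> ` topspace X = topspace Y"
      and \<phi>_act: "\<And>g y. \<lbrakk>g \<in> carrier G; y \<in> topspace X\<rbrakk> \<Longrightarrow> \<phi> (shift_act G g y) = b g (\<phi> y)"
      using \<phi> by (auto simp: factor_map_def)
    have \<phi>Y: "\<phi> y \<in> topspace Y" if "y \<in> topspace X" for y
      using \<phi>X that by blast
    have fibre: "\<phi> y = \<phi> z" if y: "y \<in> topspace X" and z: "z \<in> topspace X" and eq: "\<pi> y = \<pi> z" for y z
    proof (rule ccontr)
      assume ne: "\<phi> y \<noteq> \<phi> z"
      then have "d (\<phi> y) (\<phi> z) > 0" using \<phi>Y y z by simp
      then obtain \<delta> where \<delta>: "\<delta> > 0" "\<And>u v g. \<lbrakk>u \<in> topspace Y; v \<in> topspace Y; d u v < \<delta>; g \<in> carrier G\<rbrakk>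
           \<Longrightarrow> d (b g u) (b g v) < d (\<phi> y) (\<phi> z)"
        using equi by meson
      have xX: "x \<in> topspace X" by (rule self_in_orbit_closure[OF model_set_in_full_shift])
      have "openin Y (M.mball (\<phi> x) (\<delta> / 2))"
        using M.openin_mball d(2) by simp
      from openin_continuous_map_preimage[OF c\<phi> this]
      have "openin X {w \<in> topspace X. \<phi> w \<in> M.mball (\<phi> x) (\<delta> / 2)}" .
      moreover have "x \<in> {w \<in> topspace X. \<phi> w \<in> M.mball (\<phi> x) (\<delta> / 2)}"
        using xX \<phi>Y[OF xX] \<delta>(1) by simp
      ultimately obtain F where F: "finite F" "F \<subseteq> carrier G"
        "cylinder G F x \<inter> topspace X \<subseteq> {w \<in> topspace X. \<phi> w \<in> M.mball (\<phi> x) (\<delta> / 2)}"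
        by (rule openin_orbit_closure_cylinder)
      obtain n where n: "\<And>w \<xi>. \<lbrakk>(w, \<xi>) \<in> graph_closure; \<xi> n = \<Gamma> n\<rbrakk> \<Longrightarrow> w \<in> cylinder G F x"
        using graph_closure_fibre_one[OF F(1,2)] by blast
      obtain g where g: "g \<in> carrier G" "\<pi> y n = g <# \<Gamma> n"
        using odometer_coord_rep[OF \<pi>O[OF y]] by blast
      have close: "d (\<phi> x) (\<phi> (shift_act G (inv g) w)) < \<delta> / 2"
        if w: "w \<in> topspace X" "\<pi> w = \<pi> y" for w
      proof -
        have "\<pi> (shift_act G (inv g) w) n = \<Gamma> n"
          using g w \<pi>_act[of "inv g" w] odometer_act_coset[of "inv g" g "\<pi> y" n]
          by (simp add: lcos_mult_one subgroup.subset[OF subgroup_\<Gamma>])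
        then have "shift_act G (inv g) w \<in> cylinder G F x"
          using n \<pi>_graph actX w(1) g(1) by blast
        then show ?thesis using F(3) actX[of "inv g" w] w(1) g(1) by auto
      qed
      let ?u = "\<phi> (shift_act G (inv g) y)" and ?v = "\<phi> (shift_act G (inv g) z)"
      have uv: "?u \<in> topspace Y" "?v \<in> topspace Y" using \<phi>Y actX y z g(1) by auto
      have "d ?u ?v \<le> d ?u (\<phi> x) + d (\<phi> x) ?v"
        using M.triangle uv \<phi>Y[OF xX] by blast
      then have "d ?u ?v < \<delta>"
        using close[OF y] close[OF z] eq M.commute[of ?u "\<phi> x"] by simp
      then have "d (b g ?u) (b g ?v) < d (\<phi> y) (\<phi> z)" using \<delta>(2) uv g(1) by blast
      moreover have "b g (\<phi> (shift_act G (inv g) w)) = \<phi> w" if "w \<in> topspace X" for w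
        using that g(1) \<phi>_act[of g "shift_act G (inv g) w"] actX[of "inv g" w]
          shift_act_inv_cancel(2)[of g w] subsetD[OF orbit_closure_subset that] by simp
      ultimately show False using y z by simp
    qed
    have "quotient_map X (odometer G \<Gamma>) \<pi>"
      using \<pi> compact_space_X Hausdorff_space_odometer
      by (intro continuous_imp_quotient_map) (auto simp: factor_map_def)
    from quotient_map_lift_exists[OF this c\<phi> fibre] obtain \<psi>
      where \<psi>: "continuous_map (odometer G \<Gamma>) Y \<psi>" "\<psi> ` topspace (odometer G \<Gamma>) = \<phi> ` topspace X"
        "\<And>y. y \<in> topspace X \<Longrightarrow> \<psi> (\<pi> y) = \<phi> y" by blast
    have "factor_map G (odometer G \<Gamma>) (odometer_act G) Y b \<psi>"
      unfolding factor_map_def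
    proof (intro conjI ballI)
      show "dynamical_system G Y b" using Y by (simp add: equicontinuous_system_def)
      fix g \<xi> assume g: "g \<in> carrier G" and "\<xi> \<in> topspace (odometer G \<Gamma>)"
      then obtain y where y: "y \<in> topspace X" "\<xi> = \<pi> y"
        using \<pi> unfolding factor_map_def by blast
      show "\<psi> (odometer_act G g \<xi>) = b g (\<psi> \<xi>)"
        using \<psi>(3)[OF actX[OF g y(1)]] \<psi>(3)[OF y(1)] \<pi>_act[OF g y(1)] \<phi>_act[OF g y(1)] y(2) by simp
    qed (simp_all add: \<psi>(1,2) \<phi>X dynamical_system_odometer)
    then show ?thesis using \<psi>(3) by metis
  qed
  then show "\<exists>\<pi>. factor_map G X (shift_act G) (odometer G \<Gamma>) (odometer_act G) \<pi> \<and>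
      (\<forall>(Y :: ('a \<Rightarrow> nat) topology) b \<phi>. equicontinuous_system G Y b \<and> factor_map G X (shift_act G) Y b \<phi> \<longrightarrow>
         (\<exists>\<psi>. factor_map G (odometer G \<Gamma>) (odometer_act G) Y b \<psi> \<and> (\<forall>y\<in>topspace X. \<phi> y = \<psi> (\<pi> y))))"
    using \<pi> by blast
qed

end

section \<open>Toeplitz arrays and finite factors\<close>

context group
begin

lemma Toeplitz_finite_periods:
  assumes x: "Toeplitz G x" and "finite F" "F \<subseteq> carrier G"
  shows "\<exists>K. finite_index_subgroup G K \<and> (\<forall>h\<in>F. \<forall>\<gamma>\<in>K. x (h \<otimes> \<gamma>) = x h)"
  using assms(2,3)
proof (induction F rule: finite_induct)
  case empty
  then show ?case using finite_index_carrier by blast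
next
  case (insert g F)
  obtain K where K: "finite_index_subgroup G K" "\<forall>h\<in>F. \<forall>\<gamma>\<in>K. x (h \<otimes> \<gamma>) = x h"
    using insert by auto
  obtain H where H: "finite_index_subgroup G H" "\<forall>\<gamma>\<in>H. x (g \<otimes> \<gamma>) = x g"
    using x insert.prems unfolding Toeplitz_def by auto
  show ?case
    using finite_index_Int[OF K(1) H(1)] K(2) H(2) by (intro exI[of _ "K \<inter> H"]) auto
qed

definition suborbit_closure :: "'a set \<Rightarrow> ('a \<Rightarrow> nat) \<Rightarrow> ('a \<Rightarrow> nat) set" where
  "suborbit_closure H y = full_shift G closure_of ((\<lambda>h. shift_act G h y) ` H)"

lemma closedin_suborbit_closure: "closedin (full_shift G) (suborbit_closure H y)"
  by (simp add: suborbit_closure_def)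

lemma suborbit_closure_subset: "suborbit_closure H y \<subseteq> topspace (full_shift G)"
  by (simp add: suborbit_closure_def closure_of_subset_topspace)

lemma suborbit_in_closure:
  assumes "y \<in> topspace (full_shift G)" "H \<subseteq> carrier G" "h \<in> H"
  shows "shift_act G h y \<in> suborbit_closure H y"
proof -
  have "(\<lambda>h. shift_act G h y) ` H \<subseteq> topspace (full_shift G)"
    using assms shift_act_in_full_shift by auto
  from closure_of_subset[OF this] show ?thesis
    using assms(3) by (auto simp: suborbit_closure_def)
qed

lemma suborbit_closure_minimal:
  assumes "closedin (full_shift G) C" "\<And>h. h \<in> H \<Longrightarrow> shift_act G h y \<in> C"
  shows "suborbit_closure H y \<subseteq> C"
  unfolding suborbit_closure_def using assms by (intro closure_of_minimal) auto

text \<open>The closure of the \<open>H\<close>-orbit of \<open>x\<close> is minimal under \<open>H\<close>. Given a finite set \<open>F\<close>, let \<open>K\<close> be a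
  finite index subgroup of \<open>H\<close> whose elements are periods of \<open>x\<close> at the points of \<open>F\<close>, and let \<open>R\<close>
  represent the cosets of \<open>K\<close>. Approximate \<open>z\<close> by \<open>h x\<close>, where \<open>h\<close> lies in the coset of \<open>r \<in> R\<close>. Then
  \<open>inv r\<close> takes \<open>z\<close> to a point that agrees on \<open>F\<close> with \<open>(inv r \<otimes> h) x\<close>, and so with \<open>x\<close>. As \<open>r\<close> is only
  known after \<open>h\<close> has been chosen, the approximation must be good at \<open>k \<otimes> inv r\<close> for all \<open>k \<in> F\<close> and
  \<open>r \<in> R\<close>.\<close>

lemma Toeplitz_suborbit_recurrent:
  assumes x: "Toeplitz G x" and H: "finite_index_subgroup G H" and z: "z \<in> suborbit_closure H x"
  shows "x \<in> suborbit_closure H z"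
proof -
  have xS: "x \<in> topspace (full_shift G)" using x by (simp add: Toeplitz_def)
  have Hs: "subgroup H G" using H by (simp add: finite_index_subgroup_def)
  have "(\<lambda>h. shift_act G h z) ` H \<inter> cylinder G F x \<noteq> {}" if F: "finite F" "F \<subseteq> carrier G" for F
  proof -
    obtain K where K: "finite_index_subgroup G K" "\<And>h \<gamma>. \<lbrakk>h \<in> F; \<gamma> \<in> K\<rbrakk> \<Longrightarrow> x (h \<otimes> \<gamma>) = x h"
      using Toeplitz_finite_periods[OF x F] by blast
    obtain R where R: "finite R" "R \<subseteq> carrier G" "\<And>g. g \<in> carrier G \<Longrightarrow> \<exists>r\<in>R. inv r \<otimes> g \<in> K \<inter> H"
      using finite_transversal[OF finite_index_Int[OF K(1) H]] by blast
    let ?E = "(\<lambda>(k, r). k \<otimes> inv r) ` (F \<times> R)"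
    have "finite ?E" "?E \<subseteq> carrier G" using F R by auto
    then have "(\<lambda>h. shift_act G h x) ` H \<inter> cylinder G ?E z \<noteq> {}"
      using z unfolding suborbit_closure_def in_closure_of_full_shift_iff by blast
    then obtain h where h: "h \<in> H" "shift_act G h x \<in> cylinder G ?E z" by auto
    have hG: "h \<in> carrier G" using h(1) Hs subgroup.subset by blast
    obtain r where r: "r \<in> R" "inv r \<otimes> h \<in> K" "inv r \<otimes> h \<in> H" using R(3)[OF hG] by blast
    have rG: "r \<in> carrier G" using r R by blast
    have "(inv r \<otimes> h) \<otimes> inv h \<in> H"
      using r(3) h(1) Hs by (simp add: subgroup.m_closed subgroup.m_inv_closed)
    then have rH: "inv r \<in> H" using rG hG by (simp add: m_assoc)
    have "shift_act G (inv r) z \<in> cylinder G F x"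
      unfolding cylinder_def
    proof (intro CollectI conjI ballI)
      show "shift_act G (inv r) z \<in> topspace (full_shift G)"
        using shift_act_in_full_shift[of "inv r" z] rG z suborbit_closure_subset by blast
      fix k assume k: "k \<in> F"
      then have kG: "k \<in> carrier G" using F by blast
      have "k \<otimes> inv r \<in> ?E" using k r(1) by auto
      then have "shift_act G h x (k \<otimes> inv r) = z (k \<otimes> inv r)"
        using h(2) unfolding cylinder_def by blast
      then have "x (k \<otimes> (inv r \<otimes> h)) = z (k \<otimes> inv r)"
        using kG rG hG by (simp add: shift_act_def m_assoc)
      then show "shift_act G (inv r) z k = x k"
        using K(2)[OF k r(2)] kG by (simp add: shift_act_def)
    qed
    then show ?thesis using rH by blast
  qed
  then show ?thesis
    unfolding suborbit_closure_def in_closure_of_full_shift_iff using xS by blast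
qed

lemma shift_act_suborbit_closure:
  assumes "y \<in> topspace (full_shift G)" "H \<subseteq> carrier G" "g \<in> carrier G"
  shows "shift_act G g ` suborbit_closure H y = full_shift G closure_of ((\<lambda>h. shift_act G (g \<otimes> h) y) ` H)"
proof -
  have "(\<lambda>h. shift_act G h y) ` H \<subseteq> topspace (full_shift G)"
    using assms shift_act_in_full_shift by auto
  moreover have "shift_act G g ` (\<lambda>h. shift_act G h y) ` H = (\<lambda>h. shift_act G (g \<otimes> h) y) ` H"
    using assms(2,3) by (auto simp: image_image shift_act_mult subset_iff intro!: image_cong)
  ultimately show ?thesis
    using shift_act_closure_of[OF assms(3)] by (simp add: suborbit_closure_def)
qed

definition translates :: "'a set \<Rightarrow> ('a \<Rightarrow> nat) \<Rightarrow> ('a \<Rightarrow> nat) set set" where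
  "translates H x = (\<lambda>g. shift_act G g ` suborbit_closure H x) ` carrier G"

lemma shift_act_translate:
  assumes "g \<in> carrier G" "h \<in> carrier G"
  shows "shift_act G g ` shift_act G h ` suborbit_closure H x = shift_act G (g \<otimes> h) ` suborbit_closure H x"
  using assms by (simp add: image_image shift_act_mult)

lemma shift_act_one_translate: "shift_act G \<one> ` suborbit_closure H x = suborbit_closure H x"
  using shift_act_one suborbit_closure_subset by (force simp: image_iff)

lemma translate_absorb:
  assumes x: "x \<in> topspace (full_shift G)" and H: "subgroup H G" and g: "g \<in> carrier G" and h: "h \<in> H"
  shows "shift_act G (g \<otimes> h) ` suborbit_closure H x = shift_act G g ` suborbit_closure H x"
proof -
  have hG: "h \<in> carrier G" and HG: "H \<subseteq> carrier G" using h H subgroup.subset by blast+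
  have "(\<lambda>k. shift_act G (g \<otimes> h \<otimes> k) x) ` H = (\<lambda>k. shift_act G (g \<otimes> k) x) ` (\<lambda>k. h \<otimes> k) ` H"
    using g hG HG by (auto simp: image_image m_assoc subset_iff intro!: image_cong)
  also have "(\<lambda>k. h \<otimes> k) ` H = H"
    using coset_join3[OF hG H h] by (auto simp: l_coset_def)
  finally show ?thesis
    using shift_act_suborbit_closure[OF x HG] g hG by simp
qed

lemma finite_translates:
  assumes x: "x \<in> topspace (full_shift G)" and H: "finite_index_subgroup G H"
  shows "finite (translates H x)"
proof -
  obtain R where R: "finite R" "R \<subseteq> carrier G" "\<And>g. g \<in> carrier G \<Longrightarrow> \<exists>r\<in>R. inv r \<otimes> g \<in> H"
    using finite_transversal[OF H] by blast
  have "translates H x \<subseteq> (\<lambda>g. shift_act G g ` suborbit_closure H x) ` R"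
  proof
    fix B assume "B \<in> translates H x"
    then obtain g where g: "g \<in> carrier G" "B = shift_act G g ` suborbit_closure H x"
      by (auto simp: translates_def)
    obtain r where r: "r \<in> R" "inv r \<otimes> g \<in> H" using R(3) g by blast
    have "shift_act G (r \<otimes> (inv r \<otimes> g)) ` suborbit_closure H x = shift_act G r ` suborbit_closure H x"
      using r R(2) H x by (intro translate_absorb) (auto simp: finite_index_subgroup_def)
    moreover have "r \<otimes> (inv r \<otimes> g) = g" using r R(2) g(1) by (simp add: subset_iff flip: m_assoc)
    ultimately show "B \<in> (\<lambda>g. shift_act G g ` suborbit_closure H x) ` R" using g(2) r(1) by auto
  qed
  then show ?thesis using R(1) finite_surj by blast
qed

lemma closedin_translate:
  assumes "B \<in> translates H x" shows "closedin (full_shift G) B"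
proof -
  obtain g where g: "g \<in> carrier G" "B = shift_act G g ` suborbit_closure H x"
    using assms by (auto simp: translates_def)
  show ?thesis
    unfolding g(2)
    using homeomorphic_map_closedness_eq[OF shift_act_homeomorphic_map[OF g(1)]] closedin_suborbit_closure
    by blast
qed

lemma Union_translates:
  assumes x: "x \<in> topspace (full_shift G)" and H: "finite_index_subgroup G H"
  shows "\<Union> (translates H x) = topspace (orbit_closure G x)"
proof
  have HG: "H \<subseteq> carrier G"
    using H by (simp add: finite_index_subgroup_def subgroup.subset)
  show "\<Union> (translates H x) \<subseteq> topspace (orbit_closure G x)"
  proof
    fix z assume "z \<in> \<Union> (translates H x)"
    then obtain g where g: "g \<in> carrier G" "z \<in> shift_act G g ` suborbit_closure H x"
      by (auto simp: translates_def)
    have "(\<lambda>h. shift_act G (g \<otimes> h) x) ` H \<subseteq> (\<lambda>g. shift_act G g x) ` carrier G"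
      using g HG by auto
    from closure_of_mono[OF this] show "z \<in> topspace (orbit_closure G x)"
      using g(2) shift_act_suborbit_closure[OF x HG g(1)] unfolding topspace_orbit_closure by blast
  qed
  have "closedin (full_shift G) (\<Union> (translates H x))"
    using finite_translates[OF x H] closedin_translate by (intro closedin_Union) auto
  moreover have "(\<lambda>g. shift_act G g x) ` carrier G \<subseteq> \<Union> (translates H x)"
  proof
    fix z assume "z \<in> (\<lambda>g. shift_act G g x) ` carrier G"
    then obtain g where g: "g \<in> carrier G" "z = shift_act G g x" by blast
    have "x \<in> suborbit_closure H x"
      using suborbit_in_closure[OF x HG, of \<one>] H shift_act_one[OF x]
      by (simp add: finite_index_subgroup_def subgroup.one_closed)
    then show "z \<in> \<Union> (translates H x)" using g by (auto simp: translates_def)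
  qed
  ultimately show "topspace (orbit_closure G x) \<subseteq> \<Union> (translates H x)"
    unfolding topspace_orbit_closure by (intro closure_of_minimal)
qed

text \<open>Since \<open>H\<close> is normal, the translate by \<open>g\<close> is closed and invariant under \<open>H\<close>. It contains \<open>z\<close>, hence by
  minimality \<open>x\<close>, and hence the whole closure of the \<open>H\<close>-orbit of \<open>x\<close>.\<close>

lemma suborbit_closure_subset_translate:
  assumes x: "Toeplitz G x" and H: "finite_index_subgroup G H" "H \<lhd> G" and g: "g \<in> carrier G"
    and z: "z \<in> suborbit_closure H x" "z \<in> shift_act G g ` suborbit_closure H x"
  shows "suborbit_closure H x \<subseteq> shift_act G g ` suborbit_closure H x" (is "?A \<subseteq> ?gA")
proof -
  have xS: "x \<in> topspace (full_shift G)" using x by (simp add: Toeplitz_def)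
  have Hs: "subgroup H G" using H by (simp add: finite_index_subgroup_def)
  have HG: "H \<subseteq> carrier G" using Hs subgroup.subset by blast
  have closed: "closedin (full_shift G) ?gA"
    using g by (intro closedin_translate[of _ H x]) (auto simp: translates_def)
  have inv: "shift_act G h w \<in> ?gA" if h: "h \<in> H" and w: "w \<in> ?gA" for h w
  proof -
    have hG: "h \<in> carrier G" using h HG by blast
    let ?k = "inv g \<otimes> h \<otimes> g"
    have k: "?k \<in> H" using normal.inv_op_closed1[OF H(2)] g h by blast
    have "shift_act G h w \<in> shift_act G h ` ?gA" using w by blast
    also have "shift_act G h ` ?gA = shift_act G (h \<otimes> g) ` ?A"
      using shift_act_translate hG g by blast
    also have "h \<otimes> g = g \<otimes> ?k" using g hG by (simp flip: m_assoc)
    also have "shift_act G (g \<otimes> ?k) ` ?A = ?gA" by (rule translate_absorb[OF xS Hs g k])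
    finally show ?thesis .
  qed
  have "x \<in> suborbit_closure H z" by (rule Toeplitz_suborbit_recurrent[OF x H(1) z(1)])
  also have "\<dots> \<subseteq> ?gA" using closed inv z(2) by (intro suborbit_closure_minimal)
  finally show ?thesis using closed inv by (intro suborbit_closure_minimal)
qed

lemma translates_disjoint:
  assumes x: "Toeplitz G x" and H: "finite_index_subgroup G H" "H \<lhd> G"
    and B: "B \<in> translates H x" "C \<in> translates H x" "z \<in> B" "z \<in> C"
  shows "B = C"
proof -
  let ?A = "suborbit_closure H x"
  have sub: "shift_act G b ` ?A \<subseteq> shift_act G c ` ?A"
    if b: "b \<in> carrier G" and c: "c \<in> carrier G" and zb: "z \<in> shift_act G b ` ?A" and zc: "z \<in> shift_act G c ` ?A"
    for b c
  proof -
    have "shift_act G (inv b) z \<in> shift_act G (inv b) ` shift_act G b ` ?A"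
      "shift_act G (inv b) z \<in> shift_act G (inv b) ` shift_act G c ` ?A"
      using zb zc by blast+
    then have "shift_act G (inv b) z \<in> ?A" "shift_act G (inv b) z \<in> shift_act G (inv b \<otimes> c) ` ?A"
      using b c by (simp_all add: shift_act_translate shift_act_one_translate)
    then have "?A \<subseteq> shift_act G (inv b \<otimes> c) ` ?A"
      using suborbit_closure_subset_translate[OF x H] b c by blast
    then have "shift_act G b ` ?A \<subseteq> shift_act G b ` shift_act G (inv b \<otimes> c) ` ?A" by (rule image_mono)
    also have "\<dots> = shift_act G c ` ?A"
      using b c by (simp add: shift_act_translate flip: m_assoc)
    finally show ?thesis .
  qed
  obtain b c where bc: "b \<in> carrier G" "B = shift_act G b ` ?A" "c \<in> carrier G" "C = shift_act G c ` ?A"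
    using B(1,2) unfolding translates_def by auto
  then show ?thesis
    using sub[OF bc(1,3)] sub[OF bc(3,1)] B(3,4) by blast
qed

lemma equicontinuous_system_finite:
  assumes fin: "finite P" and cl: "\<And>g u. \<lbrakk>g \<in> carrier G; u \<in> P\<rbrakk> \<Longrightarrow> b g u \<in> P"
    and one: "\<And>u. u \<in> P \<Longrightarrow> b \<one> u = u"
    and mult: "\<And>g h u. \<lbrakk>g \<in> carrier G; h \<in> carrier G; u \<in> P\<rbrakk> \<Longrightarrow> b (g \<otimes> h) u = b g (b h u)"
  shows "equicontinuous_system G (discrete_topology P) b"
  unfolding equicontinuous_system_def
proof (intro conjI exI[of _ discrete_metric.dd] allI impI)
  show "dynamical_system G (discrete_topology P) b"
    using assms by (auto simp: dynamical_system_def compact_space_discrete_topology)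
  show "Metric_space (topspace (discrete_topology P)) discrete_metric.dd"
    by (rule metric_M_dd)
  show "Metric_space.mtopology (topspace (discrete_topology P)) discrete_metric.dd = discrete_topology P"
    by (simp add: discrete_metric.mtopology_discrete_metric)
  fix \<epsilon> :: real assume "\<epsilon> > 0"
  then show "\<exists>\<delta>>0. \<forall>u\<in>topspace (discrete_topology P). \<forall>v\<in>topspace (discrete_topology P).
      discrete_metric.dd u v < \<delta> \<longrightarrow> (\<forall>g\<in>carrier G. discrete_metric.dd (b g u) (b g v) < \<epsilon>)"
    by (intro exI[of _ 1]) (auto simp: discrete_metric.dd_def)
qed

text \<open>The finite factors made of the translates of a suborbit closure separate \<open>x\<close> from every other
  point \<open>y\<close>: if \<open>H\<close> consists of periods of \<open>x\<close> at \<open>g\<close>, then all points in the same cell as \<open>x\<close> have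
  the value \<open>x g\<close> at \<open>g\<close>. Finite factors are equicontinuous, so \<open>y\<close> and \<open>x\<close> share a cell as soon as
  \<open>\<pi> y = \<pi> x\<close>. The cells are taken as points of the factor, which is why the universal property is
  used for spaces of sets of arrays.\<close>

lemma MEF_fibre_singleton:
  assumes x: "Toeplitz G x" and count: "countable (carrier G)"
    and \<pi>: "\<And>(Y :: ('a \<Rightarrow> nat) set topology) b \<phi>.
         equicontinuous_system G Y b \<Longrightarrow> factor_map G (orbit_closure G x) (shift_act G) Y b \<phi> \<Longrightarrow>
         \<exists>\<psi>. \<forall>y\<in>topspace (orbit_closure G x). \<phi> y = \<psi> (\<pi> y)"
    and y: "y \<in> topspace (orbit_closure G x)" "\<pi> y = \<pi> x"
  shows "y = x"
proof -
  let ?X = "orbit_closure G x"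
  have xS: "x \<in> topspace (full_shift G)" using x by (simp add: Toeplitz_def)
  have xX: "x \<in> topspace ?X" by (rule self_in_orbit_closure[OF xS])
  have "y g = x g" if g: "g \<in> carrier G" for g
  proof -
    obtain H0 where H0: "finite_index_subgroup G H0" "\<forall>\<gamma>\<in>H0. x (g \<otimes> \<gamma>) = x g"
      using x g unfolding Toeplitz_def by blast
    obtain H where H: "H \<lhd> G" "finite_index_subgroup G H" "H \<subseteq> H0"
      using finite_index_normal_core[OF H0(1)] by blast
    have Hs: "subgroup H G" using H by (simp add: finite_index_subgroup_def)
    have HG: "H \<subseteq> carrier G" using Hs subgroup.subset by blast
    let ?A = "suborbit_closure H x" and ?P = "translates H x"
    have AP: "?A \<in> ?P"
      unfolding translates_def using shift_act_one_translate[of H x, symmetric] by (rule image_eqI) simp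
    define \<phi> where "\<phi> = (\<lambda>w. THE B. B \<in> ?P \<and> w \<in> B)"
    have \<phi>_eq: "\<phi> w = B" if "B \<in> ?P" "w \<in> B" for w B
      unfolding \<phi>_def using that translates_disjoint[OF x H(2,1)] by (intro the_equality) auto
    have cover: "\<exists>B\<in>?P. w \<in> B" if "w \<in> topspace ?X" for w
      using that Union_translates[OF xS H(2)] by blast
    have \<phi>: "\<phi> w \<in> ?P" "w \<in> \<phi> w" if "w \<in> topspace ?X" for w
      using cover[OF that] \<phi>_eq by blast+
    have Psub: "B \<subseteq> topspace ?X" if "B \<in> ?P" for B
      using that Union_translates[OF xS H(2)] by blast
    have Pne: "B \<noteq> {}" if "B \<in> ?P" for B
      using that suborbit_in_closure[OF xS HG subgroup.one_closed[OF Hs]] by (auto simp: translates_def)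
    have act: "shift_act G k ` B \<in> ?P" if "k \<in> carrier G" "B \<in> ?P" for k B
      using that by (force simp: translates_def shift_act_translate)
    have eq: "equicontinuous_system G (discrete_topology ?P) (\<lambda>k B. shift_act G k ` B)"
    proof (rule equicontinuous_system_finite[OF finite_translates[OF xS H(2)] act])
      show "shift_act G \<one> ` B = B" if "B \<in> ?P" for B
      proof -
        have "shift_act G \<one> w = w" if "w \<in> B" for w
          using that Psub[OF \<open>B \<in> ?P\<close>] subsetD[OF orbit_closure_subset] by (intro shift_act_one) blast
        then show ?thesis by simp
      qed
      show "shift_act G (k \<otimes> l) ` B = shift_act G k ` shift_act G l ` B"
        if "k \<in> carrier G" "l \<in> carrier G" "B \<in> ?P" for k l B
        using that by (simp add: image_image shift_act_mult)
    qed auto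
    have "factor_map G ?X (shift_act G) (discrete_topology ?P) (\<lambda>k B. shift_act G k ` B) \<phi>"
      unfolding factor_map_def
    proof (intro conjI ballI)
      show "dynamical_system G ?X (shift_act G)"
        by (rule dynamical_system_orbit_closure[OF xS count])
      show "dynamical_system G (discrete_topology ?P) (\<lambda>k B. shift_act G k ` B)"
        using eq by (simp add: equicontinuous_system_def)
      show "continuous_map ?X (discrete_topology ?P) \<phi>"
        unfolding continuous_map_closedin
      proof (intro conjI allI impI)
        show "\<phi> \<in> topspace ?X \<rightarrow> topspace (discrete_topology ?P)" using \<phi> by auto
        fix C assume "closedin (discrete_topology ?P) C"
        then have C: "C \<subseteq> ?P" by simp
        have "{w \<in> topspace ?X. \<phi> w \<in> C} = \<Union>C"
          using C \<phi> \<phi>_eq Psub by blast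
        moreover have "closedin ?X (\<Union>C)"
        proof (rule closedin_Union)
          show "finite C" using C finite_translates[OF xS H(2)] finite_subset by blast
          show "closedin ?X B" if "B \<in> C" for B
            using that C Psub closedin_translate
            by (metis closedin_subset_topspace orbit_closure_def subsetD topspace_orbit_closure)
        qed
        ultimately show "closedin ?X {w \<in> topspace ?X. \<phi> w \<in> C}" by simp
      qed
      show "\<phi> ` topspace ?X = topspace (discrete_topology ?P)"
      proof
        show "\<phi> ` topspace ?X \<subseteq> topspace (discrete_topology ?P)" using \<phi> by auto
        show "topspace (discrete_topology ?P) \<subseteq> \<phi> ` topspace ?X"
        proof
          fix B assume "B \<in> topspace (discrete_topology ?P)"
          then have B: "B \<in> ?P" by simp
          then obtain w where "w \<in> B" using Pne by blast
          then show "B \<in> \<phi> ` topspace ?X" using \<phi>_eq[OF B] Psub[OF B] by blast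
        qed
      qed
      show "\<phi> (shift_act G k w) = shift_act G k ` \<phi> w" if "k \<in> carrier G" "w \<in> topspace ?X" for k w
        using \<phi>[OF that(2)] act[OF that(1)] by (intro \<phi>_eq) auto
    qed
    from \<pi>[OF eq this] have "\<phi> y = \<phi> x" using y xX by metis
    moreover have "\<phi> x = ?A"
      using \<phi>_eq[OF AP] suborbit_in_closure[OF xS HG subgroup.one_closed[OF Hs]] shift_act_one[OF xS] by simp
    ultimately have "y \<in> ?A" using \<phi>(2)[OF y(1)] by simp
    moreover have "?A \<subseteq> cylinder G {g} x"
    proof (rule suborbit_closure_minimal)
      show "closedin (full_shift G) (cylinder G {g} x)" using g by (intro closedin_cylinder) auto
      show "shift_act G h x \<in> cylinder G {g} x" if "h \<in> H" for h
      proof -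
        have "shift_act G h x \<in> topspace (full_shift G)"
          using that HG shift_act_in_full_shift[OF _ xS] by blast
        moreover have "shift_act G h x g = x g"
          using that H(3) H0(2) g by (auto simp: shift_act_def)
        ultimately show ?thesis by (simp add: cylinder_def)
      qed
    qed
    ultimately show ?thesis by (auto simp: cylinder_def)
  qed
  moreover have "y \<in> topspace (full_shift G)" using y orbit_closure_subset by blast
  ultimately show ?thesis
    using xS by (auto simp: topspace_full_shift intro: PiE_ext)
qed

end

section \<open>The window of a Toeplitz array\<close>

locale odometer_array = normal_odometer G \<Gamma> for G (structure) and \<Gamma> :: "nat \<Rightarrow> 'a set" +
  fixes x :: "'a \<Rightarrow> nat" and \<pi> :: "('a \<Rightarrow> nat) \<Rightarrow> nat \<Rightarrow> 'a set"
  assumes x_in: "x \<in> topspace (full_shift G)"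
    and factor: "factor_map G (orbit_closure G x) (shift_act G) (odometer G \<Gamma>) (odometer_act G) \<pi>"
    and fibre: "\<And>y. \<lbrakk>y \<in> topspace (orbit_closure G x); \<pi> y = \<pi> x\<rbrakk> \<Longrightarrow> y = x"
begin

abbreviation X where "X \<equiv> orbit_closure G x"

lemma x_in_X: "x \<in> topspace X"
  by (rule self_in_orbit_closure[OF x_in])

lemma \<pi>_in: "y \<in> topspace X \<Longrightarrow> \<pi> y \<in> odometer_set G \<Gamma>"
  using factor by (auto simp: factor_map_def topspace_odometer)

lemma \<pi>_orbit: "g \<in> carrier G \<Longrightarrow> \<pi> (shift_act G g x) = odometer_act G g (\<pi> x)"
  using factor x_in_X by (simp add: factor_map_def)

text \<open>As \<open>\<Gamma> n\<close> is normal, every point of the odometer has the same stabilizer at level \<open>n\<close>, so \<open>\<pi> x\<close> may be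
  any point and need not be the identity.\<close>

lemma \<pi>_orbit_coord_iff:
  assumes g: "g \<in> carrier G"
  shows "\<pi> (shift_act G g x) n = \<pi> x n \<longleftrightarrow> g \<in> \<Gamma> n"
proof -
  obtain k where k: "k \<in> carrier G" "\<pi> x n = k <# \<Gamma> n"
    using odometer_coord_rep[OF \<pi>_in[OF x_in_X]] by blast
  have "\<pi> (shift_act G g x) n = (g \<otimes> k) <# \<Gamma> n"
    using \<pi>_orbit[OF g] odometer_act_coset[of g k "\<pi> x" n] g k by simp
  then have "\<pi> (shift_act G g x) n = \<pi> x n \<longleftrightarrow> inv k \<otimes> g \<otimes> k \<in> \<Gamma> n"
    using l_coset_eq_iff[OF subgroup_\<Gamma>, of k "g \<otimes> k" n] k g by (auto simp: m_assoc)
  also have "\<dots> \<longleftrightarrow> g \<in> \<Gamma> n"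
  proof
    assume "inv k \<otimes> g \<otimes> k \<in> \<Gamma> n"
    then have "k \<otimes> (inv k \<otimes> g \<otimes> k) \<otimes> inv k \<in> \<Gamma> n"
      using normal.inv_op_closed2[OF normal] k by blast
    moreover have "k \<otimes> (inv k \<otimes> g) = g"
      using k(1) g by (simp flip: m_assoc)
    ultimately show "g \<in> \<Gamma> n" using k(1) g by (simp add: m_assoc)
  next
    assume "g \<in> \<Gamma> n"
    then show "inv k \<otimes> g \<otimes> k \<in> \<Gamma> n"
      using normal.inv_op_closed1[OF normal] k by blast
  qed
  finally show ?thesis .
qed

text \<open>The map \<open>\<pi>\<close> is closed, so neighbourhoods of the fibre over \<open>\<pi> x\<close> contain preimages of
  neighbourhoods of \<open>\<pi> x\<close>.\<close>

lemma fibre_nbhd: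
  assumes V: "openin X V" "x \<in> V"
  obtains n where "\<And>z. \<lbrakk>z \<in> topspace X; \<pi> z n = \<pi> x n\<rbrakk> \<Longrightarrow> z \<in> V"
proof -
  have "closed_map X (odometer G \<Gamma>) \<pi>"
    using factor Hausdorff_space_odometer
    by (intro continuous_imp_closed_map) (auto simp: factor_map_def dynamical_system_def)
  moreover have "closedin X (topspace X - V)" using V(1) by blast
  ultimately have "closedin (odometer G \<Gamma>) (\<pi> ` (topspace X - V))"
    by (simp add: closed_map_def)
  then have "openin (odometer G \<Gamma>) (odometer_set G \<Gamma> - \<pi> ` (topspace X - V))"
    by (simp add: closedin_def topspace_odometer)
  moreover have "\<pi> x \<in> odometer_set G \<Gamma> - \<pi> ` (topspace X - V)"
  proof -
    have "\<pi> x \<noteq> \<pi> z" if "z \<in> topspace X - V" for z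
      using fibre[of z] that V(2) by auto
    then show ?thesis using \<pi>_in[OF x_in_X] by auto
  qed
  ultimately obtain n where n: "\<forall>\<eta>\<in>odometer_set G \<Gamma>. \<eta> n = \<pi> x n \<longrightarrow> \<eta> \<in> odometer_set G \<Gamma> - \<pi> ` (topspace X - V)"
    by (rule openin_odometer_nbhd)
  show ?thesis
  proof (rule that[of n])
    fix z assume z: "z \<in> topspace X" "\<pi> z n = \<pi> x n"
    then have "\<pi> z \<notin> \<pi> ` (topspace X - V)" using n \<pi>_in[OF z(1)] by blast
    then show "z \<in> V" using z(1) by blast
  qed
qed

text \<open>A shift by \<open>\<gamma> \<in> \<Gamma> n\<close> keeps \<open>\<pi> x\<close> fixed at level \<open>n\<close>, so for large \<open>n\<close> it moves \<open>x\<close> so little that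
  the value at \<open>g\<close> does not change.\<close>

lemma periods:
  assumes g: "g \<in> carrier G"
  obtains n where "\<And>\<gamma>. \<gamma> \<in> \<Gamma> n \<Longrightarrow> x (g \<otimes> \<gamma>) = x g"
proof -
  have "openin X (cylinder G {g} x \<inter> topspace X)"
    using openin_cylinder[of "{g}" G x] g unfolding topspace_orbit_closure
    unfolding orbit_closure_def by (intro openin_subtopology_Int) auto
  moreover have "x \<in> cylinder G {g} x \<inter> topspace X"
    using x_in x_in_X by (simp add: cylinder_def)
  ultimately obtain n where n: "\<And>z. \<lbrakk>z \<in> topspace X; \<pi> z n = \<pi> x n\<rbrakk> \<Longrightarrow> z \<in> cylinder G {g} x \<inter> topspace X"
    using fibre_nbhd by metis
  show ?thesis
  proof (rule that[of n])
    fix \<gamma> assume \<gamma>: "\<gamma> \<in> \<Gamma> n"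
    then have \<gamma>G: "\<gamma> \<in> carrier G" using subgroup.subset[OF subgroup_\<Gamma>] by blast
    then have "shift_act G \<gamma> x \<in> cylinder G {g} x"
      using n[OF orbit_in_orbit_closure[OF x_in \<gamma>G]] \<pi>_orbit_coord_iff \<gamma> by blast
    then show "x (g \<otimes> \<gamma>) = x g" using g by (simp add: cylinder_def shift_act_def)
  qed
qed

text \<open>The points with a neighbourhood on which \<open>x\<close>, regarded as a function on the image of \<open>\<tau>\<close>, is
  constantly \<open>i\<close>.\<close>

definition locally_eq :: "nat \<Rightarrow> (nat \<Rightarrow> 'a set) set" where
  "locally_eq i = {\<xi> \<in> odometer_set G \<Gamma>. \<exists>n. \<exists>g\<in>carrier G. \<xi> n = g <# \<Gamma> n \<and> (\<forall>\<gamma>\<in>\<Gamma> n. x (g \<otimes> \<gamma>) = i)}"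

text \<open>As the closure of an open set, the window is automatically the closure of its interior.\<close>

definition window where "window = odometer G \<Gamma> closure_of locally_eq 1"

lemma openin_locally_eq: "openin (odometer G \<Gamma>) (locally_eq i)"
  unfolding openin_odometer_iff
proof (intro conjI ballI)
  show "locally_eq i \<subseteq> odometer_set G \<Gamma>" by (auto simp: locally_eq_def)
  fix \<xi> assume "\<xi> \<in> locally_eq i"
  then obtain n g where "g \<in> carrier G" "\<xi> n = g <# \<Gamma> n" "\<forall>\<gamma>\<in>\<Gamma> n. x (g \<otimes> \<gamma>) = i"
    by (auto simp: locally_eq_def)
  then show "\<exists>n. \<forall>\<eta>\<in>odometer_set G \<Gamma>. \<eta> n = \<xi> n \<longrightarrow> \<eta> \<in> locally_eq i"
    by (intro exI[of _ n]) (auto simp: locally_eq_def)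
qed

lemma \<tau>_in_locally_eq:
  assumes h: "h \<in> carrier G" shows "\<tau> h \<in> locally_eq i \<longleftrightarrow> x h = i"
proof
  assume "\<tau> h \<in> locally_eq i"
  then obtain n g where g: "g \<in> carrier G" "h <# \<Gamma> n = g <# \<Gamma> n" "\<forall>\<gamma>\<in>\<Gamma> n. x (g \<otimes> \<gamma>) = i"
    by (auto simp: locally_eq_def odometer_tau_def)
  then have "h \<in> g <# \<Gamma> n" using lcos_self[OF h subgroup_\<Gamma>] by metis
  then show "x h = i" using g(3) by (auto simp: l_coset_def)
next
  assume i: "x h = i"
  obtain n where "\<And>\<gamma>. \<gamma> \<in> \<Gamma> n \<Longrightarrow> x (h \<otimes> \<gamma>) = x h"
    using periods[OF h] by blast
  then show "\<tau> h \<in> locally_eq i"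
    unfolding locally_eq_def mem_Collect_eq using h i \<tau>_in[OF h] unfolding odometer_tau_def by metis
qed

lemma locally_eq_disjoint: "locally_eq 0 \<inter> locally_eq 1 = {}"
proof (rule ccontr)
  assume "locally_eq 0 \<inter> locally_eq 1 \<noteq> {}"
  then obtain h where h: "h \<in> carrier G" "\<tau> h \<in> locally_eq 0 \<inter> locally_eq 1"
    using \<tau>_dense[OF openin_Int[OF openin_locally_eq openin_locally_eq]] by metis
  then show False using \<tau>_in_locally_eq[OF h(1)] by auto
qed

lemma locally_eq_disjoint_window: "locally_eq 0 \<inter> window = {}"
  using locally_eq_disjoint openin_locally_eq by (simp add: window_def openin_Int_closure_of_eq_empty)

lemma closedin_window: "closedin (odometer G \<Gamma>) window"
  by (simp add: window_def)

lemma x_values: "h \<in> carrier G \<Longrightarrow> x h = 0 \<or> x h = 1"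
  using x_in by (auto simp: topspace_full_shift PiE_iff)

lemma locally_eq_subset_interior: "locally_eq 1 \<subseteq> odometer G \<Gamma> interior_of window"
  unfolding window_def
  by (intro interior_of_maximal openin_locally_eq closure_of_subset openin_subset)

lemma \<tau>_in_window: "h \<in> carrier G \<Longrightarrow> \<tau> h \<in> window \<longleftrightarrow> x h = 1"
  using \<tau>_in_locally_eq[of h 0] \<tau>_in_locally_eq[of h 1] x_values[of h] locally_eq_disjoint_window locally_eq_subset_interior
    interior_of_subset[of "odometer G \<Gamma>" window] by auto

lemma model_set_window: "x = model_set G \<Gamma> window"
proof
  fix h
  show "x h = model_set G \<Gamma> window h"
  proof (cases "h \<in> carrier G")
    case True
    then show ?thesis using \<tau>_in_window[OF True] x_values[OF True] by (auto simp: model_set_def)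
  next
    case False
    then show ?thesis using x_in by (auto simp: model_set_def topspace_full_shift PiE_iff extensional_def)
  qed
qed

lemma proper_window: "proper_window G \<Gamma> window"
  unfolding proper_window_def
proof
  show "compactin (odometer G \<Gamma>) window"
    by (rule closedin_compact_space[OF compact_space_odometer closedin_window])
  show "odometer G \<Gamma> closure_of (odometer G \<Gamma> interior_of window) = window"
  proof
    show "odometer G \<Gamma> closure_of (odometer G \<Gamma> interior_of window) \<subseteq> window"
      by (intro closure_of_minimal interior_of_subset closedin_window)
    show "window \<subseteq> odometer G \<Gamma> closure_of (odometer G \<Gamma> interior_of window)"
      by (subst (1) window_def) (intro closure_of_mono locally_eq_subset_interior)
  qed
qed

lemma generic_window: "generic_window G \<Gamma> window"
  unfolding generic_window_def
proof (rule ccontr)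
  assume "odometer G \<Gamma> frontier_of window \<inter> \<tau> ` carrier G \<noteq> {}"
  then obtain h where h: "h \<in> carrier G" "\<tau> h \<in> odometer G \<Gamma> frontier_of window" by blast
  then have "\<tau> h \<in> window" "\<tau> h \<notin> odometer G \<Gamma> interior_of window"
    using closedin_window by (auto simp: frontier_of_def closure_of_closedin)
  then show False
    using \<tau>_in_window[OF h(1)] \<tau>_in_locally_eq[OF h(1)] locally_eq_subset_interior by blast
qed

text \<open>Let \<open>W \<xi> = W\<close>, and let \<open>g\<close> represent \<open>\<xi>\<close> at a high level. Then \<open>\<tau> (h \<otimes> g)\<close> is close to \<open>\<tau> h \<xi>\<close>,
  which lies in \<open>W\<close> exactly if \<open>\<tau> h\<close> does, so \<open>g x\<close> is close to \<open>x\<close>. By continuity of \<open>\<pi>\<close>, the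
  shift by \<open>g\<close> fixes \<open>\<pi> x\<close> at level \<open>n\<close>, so \<open>g \<in> \<Gamma> n\<close>.\<close>

lemma irredundant_window: "irredundant_window G \<Gamma> window"
  unfolding irredundant_window_def one_odometer_group
proof (intro ballI impI)
  fix \<xi> assume \<xi>O: "\<xi> \<in> carrier \<O>" and W: "window #>\<^bsub>\<O>\<^esub> \<xi> = window"
  then have \<xi>: "\<xi> \<in> odometer_set G \<Gamma>" by simp
  show "\<xi> = \<Gamma>"
  proof
    fix n
    let ?B = "{\<eta> \<in> odometer_set G \<Gamma>. \<eta> n = \<pi> x n}"
    have "openin (odometer G \<Gamma>) ?B"
      unfolding openin_odometer_iff by auto
    then have "openin X {z \<in> topspace X. \<pi> z \<in> ?B}"
      using factor by (intro openin_continuous_map_preimage) (auto simp: factor_map_def)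
    moreover have "x \<in> {z \<in> topspace X. \<pi> z \<in> ?B}" using x_in_X \<pi>_in by simp
    ultimately obtain F where F: "finite F" "F \<subseteq> carrier G"
      "cylinder G F x \<inter> topspace X \<subseteq> {z \<in> topspace X. \<pi> z \<in> ?B}"
      by (rule openin_orbit_closure_cylinder)
    obtain m where m: "\<And>h \<zeta>. \<lbrakk>h \<in> F; \<zeta> \<in> odometer_set G \<Gamma>; \<zeta> m = \<tau> h m\<rbrakk> \<Longrightarrow> \<zeta> \<in> window \<longleftrightarrow> \<tau> h \<in> window"
      using window_locally_decided_finite[OF closedin_window generic_window F(1,2)] by blast
    obtain g where g: "g \<in> carrier G" "\<And>k. k \<le> max m n \<Longrightarrow> \<xi> k = g <# \<Gamma> k"
      using odometer_point_rep[OF \<xi>] by blast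
    have "x (h \<otimes> g) = x h" if h: "h \<in> F" for h
    proof -
      have hG: "h \<in> carrier G" using h F(2) by blast
      \<comment> \<open>Translating back by \<open>\<xi>\<close> gives a point near \<open>\<tau> h\<close>, where membership in the window
        is locally constant.\<close>
      let ?\<zeta> = "\<tau> (h \<otimes> g) \<otimes>\<^bsub>\<O>\<^esub> inv\<^bsub>\<O>\<^esub> \<xi>"
      have hgO: "\<tau> (h \<otimes> g) \<in> carrier \<O>" and hO: "\<tau> h \<in> carrier \<O>" using \<tau>_in hG g(1) by simp_all
      have \<zeta>O: "?\<zeta> \<in> carrier \<O>" using hgO \<xi>O O.m_closed O.inv_closed by blast
      have "\<tau> (h \<otimes> g) m = (\<tau> h \<otimes>\<^bsub>\<O>\<^esub> \<xi>) m"
        using g hG odometer_mult_coset[of h g "\<tau> h" m \<xi>] by (simp add: odometer_tau_def)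
      then have "?\<zeta> m = (\<tau> h \<otimes>\<^bsub>\<O>\<^esub> \<xi> \<otimes>\<^bsub>\<O>\<^esub> inv\<^bsub>\<O>\<^esub> \<xi>) m"
        by (simp add: mult_odometer_group)
      also have "\<tau> h \<otimes>\<^bsub>\<O>\<^esub> \<xi> \<otimes>\<^bsub>\<O>\<^esub> inv\<^bsub>\<O>\<^esub> \<xi> = \<tau> h"
        using O.m_assoc[OF hO \<xi>O O.inv_closed[OF \<xi>O]] O.r_inv[OF \<xi>O] O.r_one[OF hO] by simp
      finally have "?\<zeta> \<in> window \<longleftrightarrow> \<tau> h \<in> window"
        using m[OF h, of ?\<zeta>] \<zeta>O by simp
      moreover have "?\<zeta> \<in> window \<longleftrightarrow> \<tau> (h \<otimes> g) \<in> window"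
      proof -
        have eq: "?\<zeta> \<otimes>\<^bsub>\<O>\<^esub> \<xi> = \<tau> (h \<otimes> g)"
          using O.m_assoc[OF hgO O.inv_closed[OF \<xi>O] \<xi>O] O.l_inv[OF \<xi>O] O.r_one[OF hgO] by simp
        have WO: "window \<subseteq> carrier \<O>"
          using closedin_subset[OF closedin_window] by (simp add: topspace_odometer)
        have "?\<zeta> \<otimes>\<^bsub>\<O>\<^esub> \<xi> \<in> window #>\<^bsub>\<O>\<^esub> \<xi> \<longleftrightarrow> ?\<zeta> \<in> window"
        proof
          assume "?\<zeta> \<otimes>\<^bsub>\<O>\<^esub> \<xi> \<in> window #>\<^bsub>\<O>\<^esub> \<xi>"
          then obtain \<omega> where \<omega>: "\<omega> \<in> window" "?\<zeta> \<otimes>\<^bsub>\<O>\<^esub> \<xi> = \<omega> \<otimes>\<^bsub>\<O>\<^esub> \<xi>"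
            by (auto simp: r_coset_odometer)
          then have "?\<zeta> = \<omega>" using O.right_cancel[OF \<xi>O \<zeta>O subsetD[OF WO \<omega>(1)]] by blast
          then show "?\<zeta> \<in> window" using \<omega>(1) by simp
        qed (simp add: r_coset_odometer)
        then show ?thesis unfolding eq W by blast
      qed
      ultimately have "x (h \<otimes> g) = 1 \<longleftrightarrow> x h = 1"
        using \<tau>_in_window hG g(1) by simp
      then show ?thesis using x_values[OF hG] x_values[of "h \<otimes> g"] hG g(1) by auto
    qed
    then have "shift_act G g x \<in> cylinder G F x"
      using F(2) shift_act_in_full_shift[OF g(1) x_in]
      by (auto simp: cylinder_def shift_act_def[of G g x])
    then have "\<pi> (shift_act G g x) n = \<pi> x n"
      using F(3) orbit_in_orbit_closure[OF x_in g(1)] by blast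
    then have "g \<in> \<Gamma> n" using \<pi>_orbit_coord_iff[OF g(1)] by blast
    then show "\<xi> n = \<Gamma> n" using g(2)[of n] coset_eq_\<Gamma>_iff[OF g(1)] by simp
  qed
qed

end

theorem corollary1p2:
  fixes G :: "('g, 'm) monoid_scheme"
    and \<Gamma> :: "nat \<Rightarrow> 'g set"
    and x :: "'g \<Rightarrow> nat"
  assumes "group G"
    and "countable (carrier G)"
    and "residually_finite G"
    and "odometer_sequence G \<Gamma>"
    and "\<And>n. \<Gamma> n \<lhd> G"
    and "(\<Inter>n. \<Gamma> n) = {\<one>\<^bsub>G\<^esub>}"
    and "x \<in> topspace (full_shift G)"
  shows "(Toeplitz G x \<and>
            is_MEF G (orbit_closure G x) (shift_act G) (odometer G \<Gamma>) (odometer_act G))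
         \<longleftrightarrow>
         (\<exists>W \<subseteq> topspace (odometer G \<Gamma>).
            proper_window G \<Gamma> W \<and> irredundant_window G \<Gamma> W \<and> generic_window G \<Gamma> W \<and>
            x = model_set G \<Gamma> W)"
    (is "?toeplitz \<longleftrightarrow> ?model")
proof
  interpret normal_odometer G \<Gamma>
    using assms(1,4,5) by (simp add: normal_odometer_def normal_odometer_axioms_def)
  assume toeplitz: ?toeplitz
  then have "is_MEF G (orbit_closure G x) (shift_act G) (odometer G \<Gamma>) (odometer_act G)" ..
  from is_MEF_universal[OF this]
  obtain \<pi> where \<pi>: "factor_map G (orbit_closure G x) (shift_act G) (odometer G \<Gamma>) (odometer_act G) \<pi> \<and>
      (\<forall>(Y :: ('g \<Rightarrow> nat) set topology) b \<phi>.
        equicontinuous_system G Y b \<and> factor_map G (orbit_closure G x) (shift_act G) Y b \<phi> \<longrightarrow>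
        (\<exists>\<psi>. factor_map G (odometer G \<Gamma>) (odometer_act G) Y b \<psi> \<and>
             (\<forall>y\<in>topspace (orbit_closure G x). \<phi> y = \<psi> (\<pi> y))))"
    by (rule exE)
  interpret odometer_array G \<Gamma> x \<pi>
  proof
    show "y = x" if "y \<in> topspace (orbit_closure G x)" "\<pi> y = \<pi> x" for y
    proof (rule MEF_fibre_singleton[OF _ assms(2) _ that])
      fix Y :: "('g \<Rightarrow> nat) set topology" and b \<phi>
      assume "equicontinuous_system G Y b" "factor_map G (orbit_closure G x) (shift_act G) Y b \<phi>"
      with conjunct2[OF \<pi>, rule_format, of Y b \<phi>]
      show "\<exists>\<psi>. \<forall>y\<in>topspace (orbit_closure G x). \<phi> y = \<psi> (\<pi> y)" by auto
    qed (use toeplitz in simp)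
  qed (simp_all add: assms(7) conjunct1[OF \<pi>])
  show ?model
    using closedin_subset[OF closedin_window] proper_window irredundant_window generic_window model_set_window
    by blast
next
  interpret normal_odometer G \<Gamma>
    using assms(1,4,5) by (simp add: normal_odometer_def normal_odometer_axioms_def)
  assume ?model
  then obtain W where W: "proper_window G \<Gamma> W" "irredundant_window G \<Gamma> W" "generic_window G \<Gamma> W"
    and x: "x = model_set G \<Gamma> W" by blast
  interpret W: odometer_window G \<Gamma> W
    using assms(2) W by unfold_locales
  show ?toeplitz
    using W.Toeplitz_model_set W.is_MEF_model_set x by blast
qed

end
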